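(* Let $\varphi:\mathbb R^+\to\mathbb R^+$ be an increasing function with $\varphi(n)/n\to\infty$ as $n\to\infty$. Assume that $$\limsup_{n\to\infty}\frac{\log\varphi(n)}{\sqrt n}=0.$$ Let $$S(\varphi):=\left\{x\in\mathbb I:\lim_{n\to\infty}\frac{S_n(x)}{\varphi(n)}=1\right\}.$$ Then $\dim_{\rm H}S(\varphi)=1$.
   Context: $\mathbb R^+$ is the set of positive reals and $\mathbb I:=[0,1)\setminus\mathbb Q$. For $x\in\mathbb I$, $a_1(x),a_2(x),\dots$ are the coefficients (partial quotients, positive integers) of its continued fraction expansion $x=[a_1(x),a_2(x),\dots]=1/(a_1(x)+1/(a_2(x)+\cdots))$, and $S_n(x):=\sum_{k=1}^n a_k(x)$. $\dim_{\rm H}$ denotes Hausdorff dimension. Limits in $n$ are over positive integers. *)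

theory Defs
  imports "HOL-Analysis.Analysis"
begin

subsection \<open>Hausdorff dimension\<close>

text \<open>The convention is \<open>|U|^0 = 1\<close> for nonempty \<open>U\<close>, whereas \<open>0 powr 0 = 0\<close>;
  the empty set contributes \<open>0\<close> for every exponent.\<close>

definition diam_pow :: "real \<Rightarrow> 'a::metric_space set \<Rightarrow> ennreal" where
  "diam_pow s U =
     (if U = {} then 0 else if s = 0 then 1 else ennreal (diameter U powr s))"

text \<open>Boundedness of the covering sets is required explicitly because \<open>diameter\<close> is
  meaningful only for bounded sets. Finite covers are included, padded by empty sets.\<close>

definition hausdorff_content :: "real \<Rightarrow> real \<Rightarrow> 'a::metric_space set \<Rightarrow> ennreal" where
  "hausdorff_content s \<delta> A =
     (INF U \<in> {U :: nat \<Rightarrow> 'a set.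
                 (\<forall>i. bounded (U i) \<and> diameter (U i) \<le> \<delta>) \<and> A \<subseteq> (\<Union>i. U i)}.
        \<Sum>i. diam_pow s (U i))"

definition hausdorff_measure :: "real \<Rightarrow> 'a::metric_space set \<Rightarrow> ennreal" where
  "hausdorff_measure s A = (SUP \<delta> \<in> {0<..}. hausdorff_content s \<delta> A)"

definition hausdorff_dim :: "'a::metric_space set \<Rightarrow> ereal" where
  "hausdorff_dim A = (INF s \<in> {s. 0 \<le> s \<and> hausdorff_measure s A = 0}. ereal s)"

subsection \<open>Continued fractions\<close>

definition unit_irrationals :: "real set" where
  "unit_irrationals = {0..<1} - \<rat>"

definition gauss_map :: "real \<Rightarrow> real" where
  "gauss_map x = frac (1 / x)"

text \<open>Coefficients are indexed from \<open>1\<close>; the value at index \<open>0\<close> is meaningless.\<close>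

definition cf_coeff :: "nat \<Rightarrow> real \<Rightarrow> nat" where
  "cf_coeff k x = nat \<lfloor>1 / (gauss_map ^^ (k - 1)) x\<rfloor>"

definition cf_sum :: "nat \<Rightarrow> real \<Rightarrow> nat" where
  "cf_sum n x = (\<Sum>k=1..n. cf_coeff k x)"

text \<open>The facts below confirm that \<open>cf_coeff\<close> yields the continued fraction expansion:
  the coefficients are positive, and
  \<open>x = 1 / (a\<^sub>1 + 1 / (a\<^sub>2 + \<dots> + 1 / (a\<^sub>n + t)))\<close> where \<open>t\<close>, the \<open>n\<close>-th iterate of the
  Gauss map at \<open>x\<close>, is again an irrational number in the unit interval.\<close>

primrec cf_eval :: "nat list \<Rightarrow> real \<Rightarrow> real" where
  "cf_eval [] t = t"
| "cf_eval (a # as) t = 1 / (real a + cf_eval as t)"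

lemma gauss_map_unit_irrationals:
  assumes "x \<in> unit_irrationals"
  shows "gauss_map x \<in> unit_irrationals"
proof -
  have "frac (1 / x) \<notin> \<rat>"
  proof
    assume "frac (1 / x) \<in> \<rat>"
    then have "frac (1 / x) + of_int \<lfloor>1 / x\<rfloor> \<in> \<rat>"
      by (rule Rats_add) simp
    then have "1 / x \<in> \<rat>"
      by (simp add: frac_def)
    then have "1 / (1 / x) \<in> \<rat>"
      by (rule Rats_divide[OF Rats_1])
    then show False
      using assms by (simp add: unit_irrationals_def)
  qed
  then show ?thesis
    by (simp add: unit_irrationals_def gauss_map_def frac_lt_1)
qed

lemma gauss_map_iter_unit_irrationals:
  "x \<in> unit_irrationals \<Longrightarrow> (gauss_map ^^ n) x \<in> unit_irrationals"
  by (induction n) (auto intro: gauss_map_unit_irrationals)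

lemma unit_irrationals_pos: "x \<in> unit_irrationals \<Longrightarrow> 0 < x"
  by (cases "x = 0") (auto simp: unit_irrationals_def)

lemma cf_coeff_pos:
  assumes "x \<in> unit_irrationals"
  shows "cf_coeff k x \<ge> 1"
proof -
  let ?y = "(gauss_map ^^ (k - 1)) x"
  have y: "?y \<in> unit_irrationals"
    by (rule gauss_map_iter_unit_irrationals[OF assms])
  then have "0 < ?y" "?y < 1"
    by (auto intro: unit_irrationals_pos simp: unit_irrationals_def)
  then have "1 \<le> 1 / ?y"
    by simp
  then have "1 \<le> \<lfloor>1 / ?y\<rfloor>"
    by (simp only: one_le_floor)
  then show ?thesis
    unfolding cf_coeff_def by linarith
qed

lemma gauss_map_step:
  assumes "x \<in> unit_irrationals"
  shows "x = 1 / (real (nat \<lfloor>1 / x\<rfloor>) + gauss_map x)"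
proof -
  have "0 < 1 / x"
    using unit_irrationals_pos[OF assms] by simp
  then have "0 \<le> \<lfloor>1 / x\<rfloor>"
    by (simp only: zero_le_floor less_imp_le)
  then have "real (nat \<lfloor>1 / x\<rfloor>) + gauss_map x = 1 / x"
    by (simp only: of_nat_nat gauss_map_def frac_def add_diff_eq add_diff_cancel_left')
  then show ?thesis
    by simp
qed

lemma cf_expansion:
  assumes "x \<in> unit_irrationals"
  shows "x = cf_eval (map (\<lambda>k. cf_coeff k x) [1..<Suc n]) ((gauss_map ^^ n) x)"
  using assms
proof (induction n arbitrary: x)
  case 0
  then show ?case by simp
next
  case (Suc n)
  have shift: "map (\<lambda>k. cf_coeff k x) [2..<Suc (Suc n)] =
               map (\<lambda>k. cf_coeff k (gauss_map x)) [1..<Suc n]"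
    by (rule nth_equalityI)
       (simp_all add: cf_coeff_def funpow_Suc_right del: upt_Suc funpow.simps(2))
  have "[1..<Suc (Suc n)] = 1 # [2..<Suc (Suc n)]"
    by (simp add: upt_conv_Cons numeral_2_eq_2 del: upt_Suc)
  then have "cf_eval (map (\<lambda>k. cf_coeff k x) [1..<Suc (Suc n)]) ((gauss_map ^^ Suc n) x)
      = 1 / (real (cf_coeff 1 x) + cf_eval (map (\<lambda>k. cf_coeff k (gauss_map x)) [1..<Suc n])
                                      ((gauss_map ^^ n) (gauss_map x)))"
    by (simp only: shift list.map cf_eval.simps funpow_Suc_right o_apply)
  also have "\<dots> = 1 / (real (cf_coeff 1 x) + gauss_map x)"
    by (simp only: Suc.IH[OF gauss_map_unit_irrationals[OF Suc.prems], symmetric])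
  also have "\<dots> = x"
    using gauss_map_step[OF Suc.prems] by (simp add: cf_coeff_def)
  finally show ?case by simp
qed

definition cf_sum_set :: "(real \<Rightarrow> real) \<Rightarrow> real set" where
  "cf_sum_set \<phi> =
     {x \<in> unit_irrationals. (\<lambda>n. real (cf_sum n x) / \<phi> (real n)) \<longlonglongrightarrow> 1}"

end

theory Submission
  imports Defs "HOL-Real_Asymp.Real_Asymp"
begin

text \<open>
  The upper bound holds for every subset of the unit interval. For the lower bound it is enough
  to have, for every \<open>s < 1\<close>, a map \<open>h\<close> from \<open>{0..<1}\<close> into the set whose inverse is Hoelder
  continuous with exponent \<open>s\<close>: a cover of the set then pulls back to a cover of the unit interval,
  which cannot be cheap (\<open>hausdorff_measure_pos_if_inverse_holder\<close>).

  The points \<open>h y\<close> are continued fractions of the following kind. At sparse positions a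
  prescribed large digit is inserted; all other digits are free in \<open>{1..N}\<close>. The free digits add
  up to \<open>O(n)\<close>, which is negligible against \<open>\<phi> n\<close>, so the inserted digits alone must follow
  \<open>\<phi>\<close>. They are the jumps of a step function that is updated to \<open>\<phi>\<close> whenever \<open>ln \<phi>\<close> has grown
  by more than a tolerance tending to \<open>0\<close>. An inserted digit \<open>b\<close> shrinks the cylinders
  by a factor of order \<open>b\<^sup>2\<close> without offering a choice, hence costs \<open>2 * ln b\<close> on a logarithmic
  scale. Up to \<open>n\<close> there are about \<open>ln (\<phi> n)\<close> jumps, divided by the tolerance, of cost about
  \<open>ln (\<phi> n)\<close> each. The hypothesis \<open>ln (\<phi> n) = o(\<surd>n)\<close> says that their total cost can be kept
  \<open>o(n)\<close>: this is \<open>jump_sequence_exists\<close>.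

  The free digits of \<open>h y\<close> are read off from \<open>y\<close> by an expansion in which each digit has its
  conditional Lebesgue probability given the preceding digits and given that it is at most
  \<open>N\<close>. The codes \<open>y\<close> with given first \<open>n\<close> digits therefore form an interval whose length is
  the length of the cylinder, up to a factor \<open>(1 + 2 / N) ^ n * exp (o(n))\<close> (\<open>code_contraction\<close>).
  Conversely, points that separate after \<open>n\<close> common digits are apart by a fraction of the
  length of their cylinder that is bounded below up to \<open>exp (o(n))\<close>
  (\<open>dist_ge_if_coeffs_differ\<close>). As cylinders have length at most \<open>2 ^ (- n)\<close>, all these losses
  are absorbed by lowering the exponent from \<open>1\<close> to \<open>s\<close>, provided that \<open>N\<close> is large
  (\<open>code_inverse_holder\<close>, \<open>exp_budget\<close>).
\<close>

section \<open>Bounds for the Hausdorff dimension of subsets of the unit interval\<close>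

text \<open>Cutting the unit interval into \<open>n\<close> pieces of length \<open>1 / n\<close> costs \<open>n powr (1 - s)\<close>, which
  tends to \<open>0\<close> when \<open>s > 1\<close>.\<close>

lemma hausdorff_measure_eq_0_unit_interval:
  fixes A :: "real set"
  assumes "A \<subseteq> {0..1}" "s > 1"
  shows "hausdorff_measure s A = 0"
proof -
  have "hausdorff_content s \<delta> A \<le> 0" if "\<delta> > 0" for \<delta>
  proof (rule ennreal_le_epsilon)
    fix e :: real assume e: "e > 0"
    have "(\<lambda>n. real (Suc n) powr (1 - s)) \<longlonglongrightarrow> 0"
      by (rule LIMSEQ_Suc) (use assms(2) in real_asymp)
    then have "\<forall>\<^sub>F n in sequentially. real (Suc n) powr (1 - s) < e"
      using e by (rule order_tendstoD)
    moreover have "(\<lambda>n. 1 / real (Suc n)) \<longlonglongrightarrow> 0"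
      by real_asymp
    then have "\<forall>\<^sub>F n in sequentially. 1 / real (Suc n) < \<delta>"
      using that by (rule order_tendstoD)
    ultimately have "\<forall>\<^sub>F n in sequentially. real (Suc n) powr (1 - s) < e \<and> 1 / real (Suc n) < \<delta>"
      by (rule eventually_conj)
    then obtain m where m: "real (Suc m) powr (1 - s) < e" "1 / real (Suc m) < \<delta>"
      unfolding eventually_sequentially by blast
    define n where "n = Suc m"
    have n: "n > 0" "real n powr (1 - s) < e" "1 / real n < \<delta>"
      using m by (simp_all add: n_def)
    define U where "U i = (if i < n then {real i / n .. (real i + 1) / n} else {})" for i
    have diam: "diameter (U i) = (if i < n then 1 / n else 0)" for i
      using n(1) by (auto simp: U_def diff_divide_distrib[symmetric] divide_less_cancel)
    have "bounded (U i)" for i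
      by (simp add: U_def)
    moreover have "diameter (U i) \<le> \<delta>" for i
      using n that by (simp add: diam)
    moreover have "A \<subseteq> (\<Union>i. U i)"
    proof
      fix x assume "x \<in> A"
      then have x: "0 \<le> x" "x \<le> 1"
        using assms(1) by auto
      show "x \<in> (\<Union>i. U i)"
      proof (cases "x = 1")
        case True
        then have "x \<in> U m"
          using n(1) by (simp add: U_def n_def)
        then show ?thesis by blast
      next
        case False
        define i where "i = nat \<lfloor>x * n\<rfloor>"
        have i: "real i \<le> x * n" "x * n < real i + 1"
          using x by (simp_all add: i_def)
        have "x * n < n"
          using x False n(1) by simp
        then have "i < n"
          using i by linarith
        then have "x \<in> U i"
          using i n(1) by (simp add: U_def field_simps)
        then show ?thesis by blast
      qed
    qed
    ultimately have "hausdorff_content s \<delta> A \<le> (\<Sum>i. diam_pow s (U i))"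
      unfolding hausdorff_content_def by (intro INF_lower) auto
    also have "\<dots> = (\<Sum>i<n. diam_pow s (U i))"
      by (rule suminf_finite) (auto simp: diam_pow_def U_def)
    also have "\<dots> = (\<Sum>i<n. ennreal ((1 / n) powr s))"
      using n(1) assms(2) by (intro sum.cong) (auto simp: diam_pow_def diam, auto simp: U_def divide_right_mono)
    also have "\<dots> = ennreal (n * (1 / n) powr s)"
      by (simp add: ennreal_of_nat_eq_real_of_nat ennreal_mult)
    also have "real n * (1 / n) powr s = real n powr (1 - s)"
      using n(1) by (simp add: powr_diff powr_divide)
    also have "ennreal (real n powr (1 - s)) \<le> 0 + ennreal e"
      using n(2) by (simp add: ennreal_leI)
    finally show "hausdorff_content s \<delta> A \<le> 0 + ennreal e" .
  qed
  then have "hausdorff_measure s A \<le> 0"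
    unfolding hausdorff_measure_def by (intro SUP_least) auto
  then show ?thesis by simp
qed

text \<open>The exponent \<open>0\<close> needs its own argument because \<open>diam_pow\<close> does not follow \<open>powr\<close>
  there: every nonempty covering set counts as \<open>1\<close>, so no cover of a nonempty set is free.\<close>

lemma hausdorff_measure_0_nonempty:
  assumes "A \<noteq> {}"
  shows "hausdorff_measure 0 A \<noteq> 0"
proof -
  have "1 \<le> hausdorff_content 0 1 A"
    unfolding hausdorff_content_def
  proof (rule INF_greatest)
    fix U :: "nat \<Rightarrow> 'a set"
    assume "U \<in> {U. (\<forall>i. bounded (U i) \<and> diameter (U i) \<le> 1) \<and> A \<subseteq> (\<Union>i. U i)}"
    then obtain i where "U i \<noteq> {}"
      using assms by fastforce
    then have "1 = (\<Sum>j\<in>{i}. diam_pow 0 (U j))"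
      by (simp add: diam_pow_def)
    also have "\<dots> \<le> (\<Sum>j. diam_pow 0 (U j))"
      by (rule sum_le_suminf) auto
    finally show "1 \<le> (\<Sum>j. diam_pow 0 (U j))" .
  qed
  also have "hausdorff_content 0 1 A \<le> hausdorff_measure 0 A"
    unfolding hausdorff_measure_def by (rule SUP_upper) simp
  finally show ?thesis by auto
qed

text \<open>A form of the mass distribution principle that needs no measure on \<open>A\<close> and no
  compactness. A cover of \<open>A\<close> pulls back along \<open>h\<close> to a cover of the unit interval, and the
  inverse Hoelder condition says that the preimage of a set \<open>U\<close> has diameter at most
  \<open>C * diameter U powr s\<close>. Those diameters add up to at least the Lebesgue measure \<open>1\<close>, so every
  cover of \<open>A\<close> costs at least \<open>1 / C\<close>. The map \<open>h\<close> may be as discontinuous as it likes.\<close>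

lemma hausdorff_measure_pos_if_inverse_holder:
  fixes h :: "real \<Rightarrow> 'a::metric_space"
  assumes "s > 0" "C > 0"
    and holder: "\<And>y z. y \<in> {0..<1} \<Longrightarrow> z \<in> {0..<1} \<Longrightarrow> \<bar>y - z\<bar> \<le> C * dist (h y) (h z) powr s"
    and "h ` {0..<1} \<subseteq> A"
  shows "hausdorff_measure s A \<noteq> 0"
proof -
  have "ennreal (1 / C) \<le> hausdorff_content s 1 A"
    unfolding hausdorff_content_def
  proof (rule INF_greatest)
    fix U :: "nat \<Rightarrow> 'a set"
    assume "U \<in> {U. (\<forall>i. bounded (U i) \<and> diameter (U i) \<le> 1) \<and> A \<subseteq> (\<Union>i. U i)}"
    then have U: "\<And>i. bounded (U i)" "A \<subseteq> (\<Union>i. U i)"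
      by auto
    define V where "V i = {y \<in> {0..<1}. h y \<in> U i}" for i
    have V_cover: "{0..<1} \<subseteq> (\<Union>i. V i)"
      using U(2) assms(4) by (fastforce simp: V_def)
    define J where "J i = (if V i = {} then {} else {Inf (V i)..Sup (V i)})" for i
    have J_emeasure: "emeasure lborel (J i) \<le> ennreal C * diam_pow s (U i)"
      and J_sub: "V i \<subseteq> J i" for i
    proof -
      have "bdd_below (V i)" "bdd_above (V i)"
        by (auto simp: V_def intro: bdd_belowI[of _ 0] bdd_aboveI[of _ 1])
      then show sub: "V i \<subseteq> J i"
        by (auto simp: J_def intro: cInf_lower cSup_upper)
      show "emeasure lborel (J i) \<le> ennreal C * diam_pow s (U i)"
      proof (cases "V i = {}")
        case True
        then show ?thesis
          by (simp add: J_def)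
      next
        case False
        then have ne: "U i \<noteq> {}"
          by (auto simp: V_def)
        let ?D = "C * diameter (U i) powr s"
        have "y - z \<le> ?D" if "y \<in> V i" "z \<in> V i" for y z
        proof -
          have "y - z \<le> C * dist (h y) (h z) powr s"
            using holder[of y z] that by (simp add: V_def)
          also have "\<dots> \<le> ?D"
            using assms that U(1)
            by (intro mult_left_mono powr_mono2 diameter_bounded_bound) (auto simp: V_def)
          finally show ?thesis .
        qed
        then have "y \<le> ?D + z" if "y \<in> V i" "z \<in> V i" for y z
          using that by (simp add: algebra_simps)
        then have "Sup (V i) \<le> ?D + z" if "z \<in> V i" for z
          using that False by (intro cSup_least) auto
        then have "Sup (V i) - ?D \<le> z" if "z \<in> V i" for z
          using that by (simp add: algebra_simps)
        then have "Sup (V i) - ?D \<le> Inf (V i)"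
          using False by (intro cInf_greatest)
        moreover obtain z where "z \<in> V i"
          using False by blast
        then have "Inf (V i) \<le> Sup (V i)"
          using sub False by (force simp: J_def)
        ultimately show ?thesis
          using assms ne False by (auto simp: J_def diam_pow_def ennreal_mult[symmetric] intro: ennreal_leI)
      qed
    qed
    have "1 = emeasure lborel {0..<1::real}"
      by simp
    also have "\<dots> \<le> emeasure lborel (\<Union>i. J i)"
      using V_cover J_sub by (intro emeasure_mono) (blast, simp add: J_def)
    also have "\<dots> \<le> (\<Sum>i. emeasure lborel (J i))"
      by (rule emeasure_subadditive_countably) (auto simp: J_def)
    also have "\<dots> \<le> (\<Sum>i. ennreal C * diam_pow s (U i))"
      using J_emeasure by (intro suminf_le) auto
    also have "\<dots> = ennreal C * (\<Sum>i. diam_pow s (U i))"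
      by simp
    finally have "ennreal (1 / C) * 1 \<le> ennreal (1 / C) * (ennreal C * (\<Sum>i. diam_pow s (U i)))"
      by (rule mult_left_mono) simp
    also have "\<dots> = (\<Sum>i. diam_pow s (U i))"
      using assms(2) by (simp add: mult.assoc[symmetric] ennreal_mult[symmetric])
    finally show "ennreal (1 / C) \<le> (\<Sum>i. diam_pow s (U i))"
      by simp
  qed
  also have "hausdorff_content s 1 A \<le> hausdorff_measure s A"
    unfolding hausdorff_measure_def by (rule SUP_upper) simp
  finally show ?thesis
    using assms(2) by auto
qed

lemma hausdorff_dim_eq_1I:
  fixes A :: "real set"
  assumes "A \<subseteq> {0..1}"
    and pos: "\<And>s. 0 < s \<Longrightarrow> s < 1 \<Longrightarrow> hausdorff_measure s A \<noteq> 0"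
  shows "hausdorff_dim A = 1"
proof (rule antisym)
  show "hausdorff_dim A \<le> 1"
  proof (rule ereal_le_epsilon2)
    fix e :: real assume "e > 0"
    then have "hausdorff_dim A \<le> ereal (1 + e)"
      unfolding hausdorff_dim_def
      using hausdorff_measure_eq_0_unit_interval[OF assms(1), of "1 + e"]
      by (intro INF_lower) auto
    then show "hausdorff_dim A \<le> 1 + ereal e"
      by (simp add: one_ereal_def)
  qed
  have "A \<noteq> {}"
  proof
    assume "A = {}"
    then have "hausdorff_measure (1/2) A \<le> 0"
      unfolding hausdorff_measure_def hausdorff_content_def
      by (intro SUP_least INF_lower2[of "\<lambda>_. {}"]) (auto simp: diam_pow_def)
    then show False using pos[of "1/2"] by simp
  qed
  show "1 \<le> hausdorff_dim A"
    unfolding hausdorff_dim_def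
  proof (rule INF_greatest)
    fix s assume "s \<in> {s. 0 \<le> s \<and> hausdorff_measure s A = 0}"
    then have "\<not> s < 1"
      using pos[of s] hausdorff_measure_0_nonempty[OF \<open>A \<noteq> {}\<close>] by (cases "s = 0") auto
    then show "1 \<le> ereal s"
      by simp
  qed
qed

section \<open>Continued fractions with prescribed digits\<close>

lemma cf_eval_append: "cf_eval (as @ bs) t = cf_eval as (cf_eval bs t)"
  by (induction as) auto

lemma cf_eval_nonneg: "0 \<le> t \<Longrightarrow> 0 \<le> cf_eval as t"
  by (induction as) auto

lemma inj_cf_eval: "inj (cf_eval as)"
  by (induction as) (auto simp: inj_def)

lemma continuous_on_cf_eval:
  assumes "\<forall>a \<in> set as. a \<ge> 1"
  shows "continuous_on {0..1} (cf_eval as)"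
  using assms
proof (induction as)
  case (Cons a as)
  have "real a + cf_eval as t \<noteq> 0" if "t \<in> {0..1}" for t
    using cf_eval_nonneg[of t as] that Cons.prems by (simp add: add_pos_nonneg order_less_imp_not_eq2)
  with Cons show ?case
    by (auto intro!: continuous_intros)
qed simp

text \<open>Infinite descent on denominators: if \<open>t n = p / q\<close>, then \<open>t (Suc n)\<close> is a fraction with
  denominator \<open>p < q\<close>.\<close>

lemma cf_tail_irrational:
  fixes t :: "nat \<Rightarrow> real" and d :: "nat \<Rightarrow> nat"
  assumes pos: "\<And>n. t n > 0" and lt: "\<And>n. t n < 1"
    and step: "\<And>n. t n = 1 / (real (d n) + t (Suc n))"
  shows "t n \<notin> \<rat>"
proof
  assume "t n \<in> \<rat>"
  have descent: False if "q > 0" "t n = real p / real q" for p q n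
    using that
  proof (induction q arbitrary: p n rule: less_induct)
    case (less q)
    have p: "p > 0" "p < q"
      using pos[of n] lt[of n] less.prems by (auto intro: gr0I)
    have "real p * (real (d n) + t (Suc n)) = real q"
      using step[of n] pos[of "Suc n"] less.prems p
      by (simp add: divide_simps add_nonneg_pos order_less_imp_not_eq2 mult.commute)
    then have eq: "real p * t (Suc n) = real q - real (d n * p)"
      by (simp add: algebra_simps)
    moreover have "real p * t (Suc n) > 0"
      using p pos by simp
    ultimately have "d n * p < q"
      by (simp del: of_nat_mult)
    then have "t (Suc n) = real (q - d n * p) / real p"
      using eq p by (simp add: of_nat_diff field_simps)
    with less.IH[OF p(2) p(1)] show False
      by blast
  qed
  obtain a b where "t n = real_of_int a / real_of_int b" "b > 0"
    using \<open>t n \<in> \<rat>\<close> by (metis Rats_cases' )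
  moreover from this have "a > 0"
    using pos[of n] by (simp add: zero_less_divide_iff)
  ultimately have "t n = real (nat a) / real (nat b)" "nat b > 0"
    by auto
  then show False
    using descent by blast
qed

text \<open>The images of \<open>{0..1}\<close> under \<open>cf_eval\<close> on longer and longer prefixes of the digit sequence
  are nested compact sets. A common point has for every \<open>n\<close> a tail \<open>t n\<close> in \<open>{0..1}\<close>, injectivity
  of \<open>cf_eval\<close> links consecutive tails, and the digits and the irrationality of the point
  can be read off from these links.\<close>

lemma cf_with_coeffs_exists:
  fixes d :: "nat \<Rightarrow> nat"
  assumes d: "\<And>k. d k \<ge> 1"
  shows "\<exists>x \<in> unit_irrationals. \<forall>k. cf_coeff (Suc k) x = d k"
proof -
  define K where "K n = cf_eval (map d [0..<n]) ` {0..1}" for n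
  have "K (Suc n) \<subseteq> K n" for n
  proof
    fix x assume "x \<in> K (Suc n)"
    then obtain t where "t \<in> {0..1}" "x = cf_eval (map d [0..<n]) (1 / (real (d n) + t))"
      by (auto simp: K_def cf_eval_append)
    moreover have "1 / (real (d n) + t) \<in> {0..1}"
      using d[of n] \<open>t \<in> {0..1}\<close> by (simp add: divide_simps)
    ultimately show "x \<in> K n"
      by (auto simp: K_def)
  qed
  then have "\<And>m n. m \<le> n \<Longrightarrow> K n \<subseteq> K m"
    by (rule lift_Suc_antimono_le)
  moreover have "compact (K n)" for n
    unfolding K_def using d by (intro compact_continuous_image continuous_on_cf_eval) auto
  moreover have "K n \<noteq> {}" for n
    by (simp add: K_def)
  ultimately have "\<Inter>(range K) \<noteq> {}"
    by (intro compact_nest)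
  then obtain x where "\<And>n. x \<in> K n"
    by blast
  then have "\<forall>n. \<exists>t \<in> {0..1}. x = cf_eval (map d [0..<n]) t"
    by (auto simp: K_def)
  then obtain t where t: "\<And>n. t n \<in> {0..1}" "\<And>n. x = cf_eval (map d [0..<n]) (t n)"
    by metis
  have step: "t n = 1 / (real (d n) + t (Suc n))" for n
  proof -
    have "cf_eval (map d [0..<n]) (t n) = cf_eval (map d [0..<n]) (1 / (real (d n) + t (Suc n)))"
      using t(2)[of n] t(2)[of "Suc n"] by (simp add: cf_eval_append)
    then show ?thesis
      by (rule injD[OF inj_cf_eval])
  qed
  have den: "real (d n) + t (Suc n) > 0" for n
    using d[of n] t(1)[of "Suc n"] by simp
  have pos: "t n > 0" for n
    using den[of n] step[of n] by simp
  have lt: "t n < 1" for n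
  proof -
    have "1 < real (d n) + t (Suc n)"
      using d[of n] pos[of "Suc n"] by simp
    then show ?thesis
      using step[of n] by simp
  qed
  have inv: "1 / t n = real (d n) + t (Suc n)" for n
    using step[of n] by simp
  have floor: "\<lfloor>1 / t n\<rfloor> = int (d n)" for n
    unfolding inv using pos[of "Suc n"] lt[of "Suc n"] by (simp add: floor_eq_iff)
  have "gauss_map (t n) = t (Suc n)" for n
    unfolding gauss_map_def frac_def floor by (simp add: inv)
  then have iter: "(gauss_map ^^ k) (t 0) = t k" for k
    by (induction k) auto
  have "cf_coeff (Suc k) (t 0) = d k" for k
    by (simp add: cf_coeff_def iter floor)
  moreover have "t 0 \<in> unit_irrationals"
    using pos[of 0] lt[of 0] cf_tail_irrational[of t d, OF pos lt step]
    by (simp add: unit_irrationals_def)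
  ultimately show ?thesis
    by blast
qed

section \<open>Lengths and separation of cylinders\<close>

text \<open>The ratio \<open>q\<^bsub>n-1\<^esub> / q\<^bsub>n\<^esub>\<close> of consecutive denominators of the convergents. Working with
  this ratio instead of two denominators keeps the recursions one-dimensional.
  The digits are indexed from \<open>0\<close>, so that \<open>d k\<close> stands for \<open>cf_coeff (Suc k)\<close>.\<close>

primrec den_ratio :: "(nat \<Rightarrow> nat) \<Rightarrow> nat \<Rightarrow> real" where
  "den_ratio d 0 = 0"
| "den_ratio d (Suc n) = 1 / (real (d n) + den_ratio d n)"

text \<open>The denominator \<open>q\<^bsub>n\<^esub>\<close>: the factor \<open>d n + q\<^bsub>n-1\<^esub> / q\<^bsub>n\<^esub>\<close> turns \<open>q\<^bsub>n\<^esub>\<close> into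
  \<open>d n * q\<^bsub>n\<^esub> + q\<^bsub>n-1\<^esub>\<close>.\<close>

primrec conv_den :: "(nat \<Rightarrow> nat) \<Rightarrow> nat \<Rightarrow> real" where
  "conv_den d 0 = 1"
| "conv_den d (Suc n) = conv_den d n * (real (d n) + den_ratio d n)"

text \<open>This is \<open>q\<^bsub>n\<^esub> * (q\<^bsub>n\<^esub> + q\<^bsub>n-1\<^esub>)\<close>, the reciprocal of the length of the cylinder, that is, of
  the interval of numbers whose expansion starts with the first \<open>n\<close> digits of \<open>d\<close>.\<close>

definition inverse_length :: "(nat \<Rightarrow> nat) \<Rightarrow> nat \<Rightarrow> real" where
  "inverse_length d n = (conv_den d n)\<^sup>2 * (1 + den_ratio d n)"

lemma den_ratio_bounds:
  assumes "\<And>k. d k \<ge> 1"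
  shows "0 \<le> den_ratio d n \<and> den_ratio d n \<le> 1"
proof (induction n)
  case (Suc n)
  then show ?case
    using assms[of n] by (auto simp: divide_simps)
qed simp

lemma add_den_ratio_pos:
  assumes "\<And>k. d k \<ge> 1"
  shows "real (d n) + den_ratio d n > 0"
proof -
  have "real (d n) \<ge> 1"
    using assms[of n] by simp
  then show ?thesis
    using den_ratio_bounds[of d n, OF assms] by linarith
qed

lemma conv_den_pos:
  assumes "\<And>k. d k \<ge> 1"
  shows "conv_den d n > 0"
proof (induction n)
  case (Suc n)
  then show ?case
    using add_den_ratio_pos[of d n, OF assms] by simp
qed simp

text \<open>One more digit \<open>i\<close> shrinks the cylinder by the factor
  \<open>(1 + \<theta>) / ((i + \<theta>) * (i + 1 + \<theta>))\<close>, the conditional Lebesgue probability of \<open>i\<close>.\<close>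

lemma inverse_length_Suc:
  assumes "\<And>k. d k \<ge> 1"
  shows "inverse_length d (Suc n) =
    inverse_length d n * ((d n + den_ratio d n) * (d n + 1 + den_ratio d n) / (1 + den_ratio d n))"
proof -
  have "d n + den_ratio d n > 0" "1 + den_ratio d n > 0"
    using add_den_ratio_pos[of d n, OF assms] den_ratio_bounds[of d n, OF assms] by auto
  then show ?thesis
    unfolding inverse_length_def by (simp add: field_simps power2_eq_square)
qed

text \<open>No digit has conditional probability above \<open>1 / 2\<close>. This exponential decay is what pays, when
  the exponent is lowered from \<open>1\<close> to \<open>s < 1\<close>, for all other losses.\<close>

lemma inverse_length_ge:
  assumes "\<And>k. d k \<ge> 1"
  shows "2 ^ n \<le> inverse_length d n"
proof (induction n)
  case (Suc n)
  let ?\<theta> = "den_ratio d n"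
  have \<theta>: "0 \<le> ?\<theta>" "?\<theta> \<le> 1" "d n \<ge> 1"
    using den_ratio_bounds[of d n] assms by auto
  have "2 * (1 + ?\<theta>) \<le> (d n + 1 + ?\<theta>) * (d n + ?\<theta>)"
    using \<theta> by (intro mult_mono) auto
  then have "2 \<le> (d n + ?\<theta>) * (d n + 1 + ?\<theta>) / (1 + ?\<theta>)"
    using \<theta> by (simp add: divide_simps mult.commute)
  then have "2 ^ n * 2 \<le> inverse_length d (Suc n)"
    unfolding inverse_length_Suc[of d n, OF assms]
    using Suc by (intro mult_mono) (auto simp: add_ac intro: order_trans[of 0 "2^n"])
  then show ?case by simp
qed (simp add: inverse_length_def)

lemma den_ratio_cong:
  assumes "\<And>k. k < n \<Longrightarrow> d k = e k"
  shows "den_ratio d n = den_ratio e n"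
  using assms by (induction n) auto

lemma conv_den_cong:
  assumes "\<And>k. k < n \<Longrightarrow> d k = e k"
  shows "conv_den d n = conv_den e n"
  using assms by (induction n) (auto simp: den_ratio_cong[of _ d e])

lemma gauss_iter_bounds:
  assumes "x \<in> unit_irrationals"
  shows "0 < (gauss_map ^^ n) x" "(gauss_map ^^ n) x < 1"
  using gauss_map_iter_unit_irrationals[OF assms, of n]
  by (auto intro: unit_irrationals_pos simp: unit_irrationals_def)

lemma gauss_iter_step:
  assumes "x \<in> unit_irrationals"
  shows "(gauss_map ^^ n) x = 1 / (real (cf_coeff (Suc n) x) + (gauss_map ^^ Suc n) x)"
  using gauss_map_step[OF gauss_map_iter_unit_irrationals[OF assms, of n]]
  by (simp add: cf_coeff_def)

text \<open>The factor in parentheses is \<open>q\<^bsub>n\<^esub> + q\<^bsub>n-1\<^esub> t\<close> for the tail \<open>t\<close> after \<open>n\<close> digits; passing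
  from \<open>n\<close> to \<open>Suc n\<close> divides it by \<open>t\<close>.\<close>

lemma prod_gauss_iter:
  assumes x: "x \<in> unit_irrationals"
  defines "d \<equiv> \<lambda>k. cf_coeff (Suc k) x"
  shows "(\<Prod>k<n. (gauss_map ^^ k) x) * (conv_den d n * (1 + den_ratio d n * (gauss_map ^^ n) x)) = 1"
proof (induction n)
  case (Suc n)
  define t where "t k = (gauss_map ^^ k) x" for k
  have d1: "\<And>k. d k \<ge> 1"
    using cf_coeff_pos[OF x] by (simp add: d_def)
  have "t n = 1 / (real (d n) + t (Suc n))"
    using gauss_iter_step[OF x, of n] unfolding t_def d_def by blast
  moreover have "real (d n) + t (Suc n) > 0"
    using gauss_iter_bounds[OF x, of "Suc n"] unfolding t_def by (intro add_nonneg_pos) auto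
  ultimately have tn: "t n * (real (d n) + t (Suc n)) = 1"
    by simp
  have \<theta>: "real (d n) + den_ratio d n > 0"
    using d1 by (rule add_den_ratio_pos)
  have "(\<Prod>k<Suc n. t k) * (conv_den d (Suc n) * (1 + den_ratio d (Suc n) * t (Suc n)))
      = (\<Prod>k<n. t k) * conv_den d n * (t n * (real (d n) + t (Suc n)) + den_ratio d n * t n)"
    using \<theta> by (simp add: field_simps)
  also have "\<dots> = (\<Prod>k<n. t k) * (conv_den d n * (1 + den_ratio d n * t n))"
    by (simp add: tn)
  also have "\<dots> = 1"
    using Suc by (simp add: t_def)
  finally show ?case
    by (simp add: t_def)
qed simp

text \<open>Each inverse branch \<open>u \<mapsto> 1 / (c + u)\<close> scales the distance of two points by the product
  of their images.\<close>

lemma dist_gauss_iter: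
  assumes "x \<in> unit_irrationals" "y \<in> unit_irrationals"
    and "\<And>k. k < n \<Longrightarrow> cf_coeff (Suc k) x = cf_coeff (Suc k) y"
  shows "\<bar>x - y\<bar> = (\<Prod>k<n. (gauss_map ^^ k) x) * (\<Prod>k<n. (gauss_map ^^ k) y)
    * \<bar>(gauss_map ^^ n) x - (gauss_map ^^ n) y\<bar>"
  using assms(3)
proof (induction n)
  case (Suc n)
  define t where "t k = (gauss_map ^^ k) x" for k
  define u where "u k = (gauss_map ^^ k) y" for k
  define c where "c = real (cf_coeff (Suc n) x)"
  have t: "t n = 1 / (c + t (Suc n))" and u: "u n = 1 / (c + u (Suc n))"
    using gauss_iter_step[OF assms(1), of n] gauss_iter_step[OF assms(2), of n] Suc.prems[of n]
    unfolding t_def u_def c_def by auto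
  have pos: "c + t (Suc n) > 0" "c + u (Suc n) > 0"
    using gauss_iter_bounds[OF assms(1), of "Suc n"] gauss_iter_bounds[OF assms(2), of "Suc n"]
    unfolding t_def u_def c_def by (auto intro: add_nonneg_pos)
  have "t n - u n = - (t n * u n * (t (Suc n) - u (Suc n)))"
    unfolding t u using pos by (simp add: divide_simps)
  then have "\<bar>t n - u n\<bar> = t n * u n * \<bar>t (Suc n) - u (Suc n)\<bar>"
    using gauss_iter_bounds[OF assms(1), of n] gauss_iter_bounds[OF assms(2), of n]
    by (simp add: abs_mult t_def u_def)
  then show ?case
    using Suc unfolding t_def u_def by simp
qed simp

text \<open>Bounded distortion: the branch that maps tails into a cylinder scales every distance at
  least by half of the length of the cylinder.\<close>

lemma dist_ge_dist_tails:
  assumes x: "x \<in> unit_irrationals" and y: "y \<in> unit_irrationals"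
    and eq: "\<And>k. k < n \<Longrightarrow> cf_coeff (Suc k) x = cf_coeff (Suc k) y"
  shows "\<bar>(gauss_map ^^ n) x - (gauss_map ^^ n) y\<bar> / (2 * inverse_length (\<lambda>k. cf_coeff (Suc k) x) n) \<le> \<bar>x - y\<bar>"
proof -
  define q where "q = conv_den (\<lambda>k. cf_coeff (Suc k) x) n"
  define \<theta> where "\<theta> = den_ratio (\<lambda>k. cf_coeff (Suc k) x) n"
  have q_y: "conv_den (\<lambda>k. cf_coeff (Suc k) y) n = q" and \<theta>_y: "den_ratio (\<lambda>k. cf_coeff (Suc k) y) n = \<theta>"
    unfolding q_def \<theta>_def by (auto intro!: conv_den_cong den_ratio_cong eq[symmetric])
  have q: "q > 0" and \<theta>: "0 \<le> \<theta>" "\<theta> \<le> 1"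
    unfolding q_def \<theta>_def
    using conv_den_pos[of "\<lambda>k. cf_coeff (Suc k) x"] den_ratio_bounds[of "\<lambda>k. cf_coeff (Suc k) x"]
      cf_coeff_pos[OF x] by auto
  have prod_ge: "1 / (q * (1 + \<theta>)) \<le> (\<Prod>k<n. (gauss_map ^^ k) z)"
    if z: "z \<in> unit_irrationals"
      and "conv_den (\<lambda>k. cf_coeff (Suc k) z) n = q" "den_ratio (\<lambda>k. cf_coeff (Suc k) z) n = \<theta>" for z
  proof -
    define t where "t = (gauss_map ^^ n) z"
    have t: "0 < t" "t < 1"
      using gauss_iter_bounds[OF z] by (auto simp: t_def)
    then have "\<theta> * t \<le> \<theta>"
      using \<theta> by (simp add: mult_left_le)
    then have "q * (1 + \<theta> * t) \<le> q * (1 + \<theta>)" "q * (1 + \<theta> * t) > 0"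
      using q \<theta> t by (auto intro!: mult_left_mono mult_pos_pos add_pos_nonneg)
    then have "1 / (q * (1 + \<theta>)) \<le> 1 / (q * (1 + \<theta> * t))"
      by (intro divide_left_mono) auto
    also have "\<dots> = (\<Prod>k<n. (gauss_map ^^ k) z)"
      using prod_gauss_iter[OF z, of n] \<open>q * (1 + \<theta> * t) > 0\<close> unfolding that(2,3) t_def
      by (metis nonzero_eq_divide_eq less_irrefl)
    finally show ?thesis .
  qed
  have "1 / (2 * inverse_length (\<lambda>k. cf_coeff (Suc k) x) n) = 1 / (2 * (q\<^sup>2 * (1 + \<theta>)))"
    by (simp add: inverse_length_def q_def \<theta>_def)
  also have "\<dots> \<le> 1 / (q * (1 + \<theta>)) * (1 / (q * (1 + \<theta>)))"
  proof -
    have "(q * (1 + \<theta>)) * (q * (1 + \<theta>)) = (1 + \<theta>) * (q\<^sup>2 * (1 + \<theta>))"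
      by (simp add: power2_eq_square)
    also have "\<dots> \<le> 2 * (q\<^sup>2 * (1 + \<theta>))"
      using q \<theta> by (intro mult_right_mono) auto
    finally show ?thesis
      using q \<theta> by (simp only: times_divide_times_eq mult_1) (intro divide_left_mono mult_pos_pos, auto)
  qed
  also have "\<dots> \<le> (\<Prod>k<n. (gauss_map ^^ k) x) * (\<Prod>k<n. (gauss_map ^^ k) y)"
    using q \<theta> q_y \<theta>_y prod_ge[OF x] prod_ge[OF y]
      prod_nonneg[of "{..<n}" "\<lambda>k. (gauss_map ^^ k) x"] gauss_iter_bounds(1)[OF x]
    by (intro mult_mono) (auto simp: q_def \<theta>_def less_imp_le)
  finally have "1 / (2 * inverse_length (\<lambda>k. cf_coeff (Suc k) x) n) * \<bar>(gauss_map ^^ n) x - (gauss_map ^^ n) y\<bar>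
     \<le> (\<Prod>k<n. (gauss_map ^^ k) x) * (\<Prod>k<n. (gauss_map ^^ k) y) * \<bar>(gauss_map ^^ n) x - (gauss_map ^^ n) y\<bar>"
    by (rule mult_right_mono) simp
  then show ?thesis
    using dist_gauss_iter[OF x y eq] by simp
qed

text \<open>A tail \<open>1 / (a + v)\<close> comes close to \<open>1\<close> only if \<open>a = 1\<close> and \<open>v\<close> is small, and \<open>v\<close> is small
  only if the digit after \<open>a\<close> is large. Hence that second digit alone controls the distance
  to \<open>1\<close>.\<close>

lemma one_minus_tail_ge:
  assumes x: "x \<in> unit_irrationals"
  shows "1 / (2 * (real (cf_coeff (Suc (Suc n)) x) + 1)) \<le> 1 - (gauss_map ^^ n) x"
proof -
  define u where "u = (gauss_map ^^ n) x"
  define v where "v = (gauss_map ^^ Suc n) x"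
  define w where "w = (gauss_map ^^ Suc (Suc n)) x"
  define a where "a = real (cf_coeff (Suc n) x)"
  define b where "b = real (cf_coeff (Suc (Suc n)) x)"
  have u: "u = 1 / (a + v)" and v: "v = 1 / (b + w)"
    using gauss_iter_step[OF x, of n] gauss_iter_step[OF x, of "Suc n"]
    unfolding u_def v_def w_def a_def b_def by auto
  have bounds: "0 < v" "v < 1" "0 < w" "w < 1"
    using gauss_iter_bounds[OF x] unfolding v_def w_def by blast+
  have ab: "a \<ge> 1" "b \<ge> 1"
    using cf_coeff_pos[OF x] by (auto simp: a_def b_def)
  have "u \<le> 1 / (1 + v)"
    unfolding u using ab bounds by (intro divide_left_mono) auto
  then have "1 - u \<ge> v / (1 + v)"
    using bounds by (simp add: field_simps)
  have "v / 2 \<le> v / (1 + v)"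
    using bounds by (intro divide_left_mono) auto
  have v_ge: "1 / (b + 1) \<le> v"
    unfolding v using ab bounds by (intro divide_left_mono) auto
  have "1 / (2 * (b + 1)) = 1 / (b + 1) / 2"
    by simp
  also have "\<dots> \<le> v / 2"
    using v_ge by (rule divide_right_mono) simp
  finally show ?thesis
    using \<open>1 - u \<ge> v / (1 + v)\<close> \<open>v / 2 \<le> v / (1 + v)\<close>
    unfolding u_def[symmetric] b_def[symmetric] by linarith
qed

text \<open>Tails with different first digits \<open>i < j\<close> lie in different intervals \<open>(1 / (i + 1), 1 / i)\<close>.
  They can still be close, namely when the first one is near the left end \<open>1 / (i + 1)\<close> of its
  interval, and \<open>one_minus_tail_ge\<close> excludes this up to a factor \<open>D\<close>.\<close>

lemma dist_tails_ge:
  assumes x: "x \<in> unit_irrationals" and y: "y \<in> unit_irrationals"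
    and less: "cf_coeff (Suc n) x < cf_coeff (Suc n) y"
    and le: "cf_coeff (Suc n) y \<le> N" and D: "cf_coeff (n + 3) x \<le> D"
  shows "1 / (2 * (real N + 1)\<^sup>2 * (real D + 1)) \<le> \<bar>(gauss_map ^^ n) x - (gauss_map ^^ n) y\<bar>"
proof -
  define i where "i = real (cf_coeff (Suc n) x)"
  define j where "j = real (cf_coeff (Suc n) y)"
  define t where "t = (gauss_map ^^ n) x"
  define t' where "t' = (gauss_map ^^ n) y"
  define u where "u = (gauss_map ^^ Suc n) x"
  define u' where "u' = (gauss_map ^^ Suc n) y"
  have t: "t = 1 / (i + u)" and t': "t' = 1 / (j + u')"
    using gauss_iter_step[OF x, of n] gauss_iter_step[OF y, of n]
    unfolding t_def t'_def u_def u'_def i_def j_def by auto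
  have u: "0 < u" "u < 1" and u': "0 < u'" "u' < 1"
    using gauss_iter_bounds[OF x] gauss_iter_bounds[OF y] unfolding u_def u'_def by blast+
  have ij: "i \<ge> 1" "j \<ge> i + 1" "j \<le> N"
    using cf_coeff_pos[OF x] less le unfolding i_def j_def by auto
  have "1 / (2 * (real D + 1)) \<le> 1 / (2 * (real (cf_coeff (Suc (Suc (Suc n))) x) + 1))"
    using D by (intro divide_left_mono) (auto simp: numeral_3_eq_3)
  also have "\<dots> \<le> 1 - u"
    unfolding u_def by (rule one_minus_tail_ge[OF x])
  finally have 1: "1 / (2 * (real D + 1)) \<le> 1 - u" .
  have prod: "(i + u) * (j + u') \<le> (real N + 1)\<^sup>2"
    unfolding power2_eq_square using ij u u' by (intro mult_mono) auto
  have pos: "(i + u) * (j + u') > 0"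
    using ij u u' by (intro mult_pos_pos) auto
  have "1 / (2 * (real N + 1)\<^sup>2 * (real D + 1)) = 1 / (2 * (real D + 1)) / (real N + 1)\<^sup>2"
    by simp
  also have "\<dots> \<le> (1 - u) / ((i + u) * (j + u'))"
    using 1 prod pos u by (intro frac_le) auto
  also have "\<dots> \<le> (j + u' - (i + u)) / ((i + u) * (j + u'))"
    using ij u' pos by (intro divide_right_mono) auto
  also have "\<dots> = t - t'"
  proof -
    have "i + u > 0" "j + u' > 0" using ij u u' by auto
    then show ?thesis unfolding t t' by (simp add: field_simps)
  qed
  finally show ?thesis
    unfolding t_def t'_def by linarith
qed

text \<open>Points that separate at level \<open>n\<close> are apart by a fixed fraction of the cylinder that they
  share, except for the loss through a large digit two places later.\<close>

lemma dist_ge_if_coeffs_differ: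
  assumes x: "x \<in> unit_irrationals" and y: "y \<in> unit_irrationals"
    and eq: "\<And>k. k < n \<Longrightarrow> cf_coeff (Suc k) x = cf_coeff (Suc k) y"
    and neq: "cf_coeff (Suc n) x \<noteq> cf_coeff (Suc n) y"
    and N: "cf_coeff (Suc n) x \<le> N" "cf_coeff (Suc n) y \<le> N"
    and D: "cf_coeff (n + 3) x \<le> D" "cf_coeff (n + 3) y \<le> D"
  shows "1 / (4 * (real N + 1)\<^sup>2 * (real D + 1) * inverse_length (\<lambda>k. cf_coeff (Suc k) x) n) \<le> \<bar>x - y\<bar>"
proof -
  let ?M = "inverse_length (\<lambda>k. cf_coeff (Suc k) x) n"
  have M: "?M > 0"
    using inverse_length_ge[of "\<lambda>k. cf_coeff (Suc k) x" n] cf_coeff_pos[OF x]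
    by (auto intro: less_le_trans[of 0 "2 ^ n"])
  have "1 / (2 * (real N + 1)\<^sup>2 * (real D + 1)) \<le> \<bar>(gauss_map ^^ n) x - (gauss_map ^^ n) y\<bar>"
  proof (cases "cf_coeff (Suc n) x < cf_coeff (Suc n) y")
    case True
    then show ?thesis by (rule dist_tails_ge[OF x y _ N(2) D(1)])
  next
    case False
    then have "cf_coeff (Suc n) y < cf_coeff (Suc n) x"
      using neq by simp
    then show ?thesis
      using dist_tails_ge[OF y x _ N(1) D(2)] by (simp add: abs_minus_commute)
  qed
  then have "1 / (2 * (real N + 1)\<^sup>2 * (real D + 1)) / (2 * ?M)
      \<le> \<bar>(gauss_map ^^ n) x - (gauss_map ^^ n) y\<bar> / (2 * ?M)"
    using M by (intro divide_right_mono) auto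
  also have "\<dots> \<le> \<bar>x - y\<bar>"
    by (rule dist_ge_dist_tails[OF x y eq])
  finally show ?thesis
    by (simp add: mult.assoc mult.left_commute)
qed

section \<open>Sparse jumps that follow a given function\<close>

text \<open>The numbers \<open>\<beta> k > 0\<close> are the large digits to be inserted, \<open>\<beta> k = 0\<close> means that position
  \<open>k\<close> stays free. The function \<open>f\<close> is replaced by a step function \<open>\<psi>\<close> that stays constant as
  long as possible and jumps up to \<open>f\<close> as soon as \<open>ln f\<close> exceeds \<open>ln \<psi>\<close> by more than a
  tolerance \<open>\<epsilon> n\<close>. If \<open>\<epsilon> n\<close> tends to \<open>0\<close>, then \<open>\<psi>\<close> is asymptotic to \<open>f\<close>; the numbers \<open>\<beta>\<close>
  are the rounded jumps of \<open>\<psi>\<close>, and the rounding error is \<open>O(n)\<close>, which is negligible.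

  A jump costs at most \<open>\<Lambda> n = ln (f n + 3)\<close> and raises \<open>ln \<psi>\<close> by at least \<open>\<epsilon> n\<close>. As
  \<open>ln \<psi>\<close> has only about \<open>\<Lambda> n\<close> of room, the total cost is at most of order \<open>\<Lambda> n * \<Lambda> n / \<epsilon> n\<close>.
  This can be \<open>o(n)\<close> for some \<open>\<epsilon> n\<close> tending to \<open>0\<close> exactly when \<open>\<Lambda> n = o(\<surd>n)\<close>, which is
  where the growth condition comes from.\<close>

lemma jump_sequence_exists:
  fixes f :: "nat \<Rightarrow> real"
  assumes pos: "\<And>n. n \<ge> 1 \<Longrightarrow> f n > 0"
    and mono: "\<And>m n. 1 \<le> m \<Longrightarrow> m \<le> n \<Longrightarrow> f m \<le> f n"
    and superlinear: "filterlim (\<lambda>n. f n / real n) at_top sequentially"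
    and growth: "(\<lambda>n. ln (f n + 3) / sqrt (real n)) \<longlonglongrightarrow> 0"
  shows "\<exists>\<beta> :: nat \<Rightarrow> nat.
    (\<lambda>n. (\<Sum>k<n. real (\<beta> k)) / f n) \<longlonglongrightarrow> 1 \<and>
    (\<lambda>n. (\<Sum>k<n. if \<beta> k = 0 then 0 else ln (real (\<beta> k) + 2)) / real n) \<longlonglongrightarrow> 0"
proof -
  define \<Lambda> where "\<Lambda> n = ln (f n + 3)" for n
  \<comment> \<open>The tolerance is the square root of \<open>\<Lambda> n / sqrt n\<close>: it tends to \<open>0\<close>, and the ratio
    \<open>a n = \<Lambda> n / \<epsilon> n\<close>, the price of one unit of growth of \<open>ln \<psi>\<close>, is increasing in \<open>n\<close>.\<close>
  define \<epsilon> where "\<epsilon> n = sqrt (\<Lambda> n / sqrt (real n))" for n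
  define a where "a n = sqrt (\<Lambda> n * sqrt (real n))" for n
  define \<psi> where "\<psi> = rec_nat (f 1) (\<lambda>n p. if ln (f (Suc n)) > ln p + \<epsilon> (Suc n) then f (Suc n) else p)"
  have \<psi>_0: "\<psi> 0 = f 1"
    and \<psi>_Suc: "\<And>n. \<psi> (Suc n) = (if ln (f (Suc n)) > ln (\<psi> n) + \<epsilon> (Suc n) then f (Suc n) else \<psi> n)"
    by (simp_all add: \<psi>_def)
  define \<beta> where "\<beta> n = nat \<lceil>\<psi> (Suc n) - \<psi> n\<rceil>" for n
  define c where "c k = (if \<beta> k = 0 then 0 else ln (real (\<beta> k) + 2))" for k
  have \<Lambda>_pos: "\<Lambda> n > 0" if "n \<ge> 1" for n
    using pos[OF that] by (simp add: \<Lambda>_def)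
  have \<Lambda>_mono: "\<Lambda> m \<le> \<Lambda> n" if "1 \<le> m" "m \<le> n" for m n
    using pos[OF that(1)] pos[of n] mono[OF that] that by (simp add: \<Lambda>_def)
  have a_\<epsilon>: "a n * \<epsilon> n = \<Lambda> n" if "n \<ge> 1" for n
    using \<Lambda>_pos[OF that] that by (simp add: a_def \<epsilon>_def real_sqrt_mult[symmetric])
  have \<epsilon>_nonneg: "\<epsilon> n \<ge> 0" if "n \<ge> 1" for n
    using \<Lambda>_pos[OF that] by (simp add: \<epsilon>_def)
  have a_mono: "a m \<le> a n" if "1 \<le> m" "m \<le> n" for m n
    unfolding a_def using \<Lambda>_mono[OF that] \<Lambda>_pos[of m] that
    by (intro real_sqrt_le_mono mult_mono) auto
  have \<psi>_pos: "\<psi> n > 0" for n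
    by (induction n) (auto simp: \<psi>_0 \<psi>_Suc pos)
  have jump: "\<psi> n < f (Suc n)" if "ln (f (Suc n)) > ln (\<psi> n) + \<epsilon> (Suc n)" for n
  proof -
    have "ln (\<psi> n) < ln (f (Suc n))"
      using that \<epsilon>_nonneg[of "Suc n"] by simp
    then show ?thesis
      using \<psi>_pos pos[of "Suc n"] by simp
  qed
  have \<psi>_mono: "\<psi> n \<le> \<psi> (Suc n)" for n
    using jump[of n] by (auto simp: \<psi>_Suc)
  have \<psi>_le_aux: "\<psi> n \<le> f (Suc n)" for n
  proof (induction n)
    case (Suc n)
    then show ?case
      using mono[of "Suc n" "Suc (Suc n)"] by (auto simp: \<psi>_Suc)
  qed (simp add: \<psi>_0)
  have \<psi>_le: "\<psi> n \<le> f n" if n: "n \<ge> 1" for n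
  proof -
    obtain m where m: "n = Suc m" using n by (cases n) auto
    show ?thesis using \<psi>_le_aux[of m] by (simp add: m \<psi>_Suc)
  qed
  have \<psi>_ge: "ln (f n) \<le> ln (\<psi> n) + \<epsilon> n" if n: "n \<ge> 1" for n
  proof -
    obtain m where m: "n = Suc m" using n by (cases n) auto
    show ?thesis using \<epsilon>_nonneg[OF n] by (auto simp: m \<psi>_Suc)
  qed

  have sum_\<beta>: "\<psi> n - \<psi> 0 \<le> (\<Sum>k<n. real (\<beta> k))" "(\<Sum>k<n. real (\<beta> k)) \<le> \<psi> n - \<psi> 0 + real n" for n
  proof -
    have *: "\<psi> (Suc k) - \<psi> k \<le> real (\<beta> k)" "real (\<beta> k) \<le> \<psi> (Suc k) - \<psi> k + 1" for k
      using \<psi>_mono[of k] unfolding \<beta>_def by linarith+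
    have "\<psi> n - \<psi> 0 = (\<Sum>k<n. \<psi> (Suc k) - \<psi> k)"
      by (simp add: sum_lessThan_telescope)
    then show "\<psi> n - \<psi> 0 \<le> (\<Sum>k<n. real (\<beta> k))"
      using * by (simp add: sum_mono)
    have "(\<Sum>k<n. real (\<beta> k)) \<le> (\<Sum>k<n. \<psi> (Suc k) - \<psi> k + 1)"
      by (intro sum_mono *)
    also have "\<dots> = \<psi> n - \<psi> 0 + real n"
      by (simp add: sum.distrib sum_lessThan_telescope)
    finally show "(\<Sum>k<n. real (\<beta> k)) \<le> \<psi> n - \<psi> 0 + real n" .
  qed

  \<comment> \<open>Telescoping of the estimate ``cost of a jump \<open>\<le>\<close> price times gain of \<open>ln \<psi>\<close>'', where
    earlier prices may be replaced by the current one because \<open>a\<close> is increasing.\<close>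
  have cost: "(\<Sum>k<n. c k) \<le> a n * (ln (\<psi> n) - ln (\<psi> 0))" if "n \<ge> 1" for n
    using that
  proof (induction n rule: dec_induct)
    case base
    have "\<psi> 1 = \<psi> 0" by (simp add: \<psi>_0 \<psi>_Suc)
    then show ?case by (simp add: c_def \<beta>_def)
  next
    case (step n)
    have ln_mono: "ln (\<psi> 0) \<le> ln (\<psi> n)"
      using lift_Suc_mono_le[of \<psi> 0 n] \<psi>_mono \<psi>_pos by simp
    have "c n \<le> a (Suc n) * (ln (\<psi> (Suc n)) - ln (\<psi> n))"
    proof (cases "ln (f (Suc n)) > ln (\<psi> n) + \<epsilon> (Suc n)")
      case True
      then have \<psi>: "\<psi> (Suc n) = f (Suc n)"
        by (simp add: \<psi>_Suc)
      have "real (\<beta> n) \<le> f (Suc n) + 1"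
        using \<psi>_pos[of n] jump[OF True] unfolding \<beta>_def \<psi> by linarith
      then have "c n \<le> \<Lambda> (Suc n)"
        using \<Lambda>_pos[of "Suc n"] by (simp add: c_def \<Lambda>_def)
      also have "\<dots> = a (Suc n) * \<epsilon> (Suc n)"
        by (simp add: a_\<epsilon>)
      also have "\<dots> \<le> a (Suc n) * (ln (\<psi> (Suc n)) - ln (\<psi> n))"
        using True \<Lambda>_pos[of "Suc n"] by (intro mult_left_mono) (auto simp: \<psi> a_def)
      finally show ?thesis .
    next
      case False
      then have "\<psi> (Suc n) = \<psi> n"
        by (simp add: \<psi>_Suc)
      then show ?thesis
        by (simp add: c_def \<beta>_def)
    qed
    moreover have "(\<Sum>k<n. c k) \<le> a (Suc n) * (ln (\<psi> n) - ln (\<psi> 0))"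
      using step a_mono[of n "Suc n"] ln_mono
      by (meson diff_ge_0_iff_ge le_SucI mult_right_mono order_trans order_refl)
    ultimately show ?case
      by (simp add: algebra_simps)
  qed

  have r0: "(\<lambda>n. \<Lambda> n / sqrt (real n)) \<longlonglongrightarrow> 0"
    using growth by (simp add: \<Lambda>_def)
  have \<epsilon>0: "\<epsilon> \<longlonglongrightarrow> 0"
    using tendsto_real_sqrt[OF r0] by (simp add: \<epsilon>_def[abs_def])
  have f_infinite: "filterlim f at_top sequentially"
  proof (rule filterlim_at_top_mono)
    show "filterlim (\<lambda>n. real n) at_top sequentially"
      by (rule filterlim_real_sequentially)
    have "\<forall>\<^sub>F n in sequentially. f n / real n \<ge> 1"
      using superlinear by (auto simp: filterlim_at_top)
    then show "\<forall>\<^sub>F n in sequentially. real n \<le> f n"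
      using eventually_gt_at_top[of 0] by eventually_elim (simp add: field_simps)
  qed
  have const_f: "(\<lambda>n. C / f n) \<longlonglongrightarrow> 0" for C
    using tendsto_divide_0[OF tendsto_const filterlim_at_top_imp_at_infinity[OF f_infinite]] .
  have n_f: "(\<lambda>n. real n / f n) \<longlonglongrightarrow> 0"
    using tendsto_inverse_0_at_top[OF superlinear] by (simp add: inverse_eq_divide)

  have \<psi>_f: "(\<lambda>n. \<psi> n / f n) \<longlonglongrightarrow> 1"
  proof (rule tendsto_sandwich)
    show "\<forall>\<^sub>F n in sequentially. exp (- \<epsilon> n) \<le> \<psi> n / f n"
      using eventually_ge_at_top[of 1]
    proof eventually_elim
      case (elim n)
      have "exp (- \<epsilon> n) \<le> exp (ln (\<psi> n) - ln (f n))"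
        using \<psi>_ge[OF elim] by simp
      also have "\<dots> = \<psi> n / f n"
        using \<psi>_pos[of n] pos[OF elim] by (simp add: exp_diff)
      finally show ?case .
    qed
    show "\<forall>\<^sub>F n in sequentially. \<psi> n / f n \<le> 1"
      using eventually_ge_at_top[of 1]
      by eventually_elim (use \<psi>_le pos in simp)
    show "(\<lambda>n. exp (- \<epsilon> n)) \<longlonglongrightarrow> 1"
      using tendsto_exp[OF tendsto_minus[OF \<epsilon>0]] by simp
  qed simp
  have "(\<lambda>n. (\<Sum>k<n. real (\<beta> k)) / f n) \<longlonglongrightarrow> 1"
  proof (rule tendsto_sandwich)
    show "\<forall>\<^sub>F n in sequentially. \<psi> n / f n - \<psi> 0 / f n \<le> (\<Sum>k<n. real (\<beta> k)) / f n"
      using eventually_ge_at_top[of 1]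
    proof eventually_elim
      case (elim n)
      show ?case
        using divide_right_mono[OF sum_\<beta>(1)[of n], of "f n"] pos[OF elim]
        by (simp add: diff_divide_distrib)
    qed
    show "\<forall>\<^sub>F n in sequentially. (\<Sum>k<n. real (\<beta> k)) / f n \<le> \<psi> n / f n - \<psi> 0 / f n + real n / f n"
      using eventually_ge_at_top[of 1]
    proof eventually_elim
      case (elim n)
      show ?case
        using divide_right_mono[OF sum_\<beta>(2)[of n], of "f n"] pos[OF elim]
        by (simp add: diff_divide_distrib add_divide_distrib)
    qed
    show "(\<lambda>n. \<psi> n / f n - \<psi> 0 / f n) \<longlonglongrightarrow> 1"
      using tendsto_diff[OF \<psi>_f const_f[of "\<psi> 0"]] by simp
    show "(\<lambda>n. \<psi> n / f n - \<psi> 0 / f n + real n / f n) \<longlonglongrightarrow> 1"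
      using tendsto_add[OF tendsto_diff[OF \<psi>_f const_f[of "\<psi> 0"]] n_f] by simp
  qed
  moreover have "(\<lambda>n. (\<Sum>k<n. c k) / real n) \<longlonglongrightarrow> 0"
  proof (rule tendsto_sandwich)
    show "\<forall>\<^sub>F n in sequentially. 0 \<le> (\<Sum>k<n. c k) / real n"
      by (intro always_eventually allI divide_nonneg_nonneg sum_nonneg) (auto simp: c_def)
    show "\<forall>\<^sub>F n in sequentially. (\<Sum>k<n. c k) / real n
        \<le> \<epsilon> n * (\<Lambda> n / sqrt (real n) - ln (\<psi> 0) / sqrt (real n))"
      using eventually_ge_at_top[of 1]
    proof eventually_elim
      case (elim n)
      have "ln (\<psi> n) \<le> \<Lambda> n"
        using \<psi>_le[OF elim] \<psi>_pos[of n] pos[OF elim] by (simp add: \<Lambda>_def)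
      then have "a n * (ln (\<psi> n) - ln (\<psi> 0)) \<le> a n * (\<Lambda> n - ln (\<psi> 0))"
        using \<Lambda>_pos[OF elim] by (intro mult_left_mono) (auto simp: a_def)
      then have "(\<Sum>k<n. c k) / real n \<le> a n * (\<Lambda> n - ln (\<psi> 0)) / real n"
        using cost[OF elim] by (intro divide_right_mono) auto
      also have "a n = \<epsilon> n * sqrt (real n)"
        using elim unfolding a_def \<epsilon>_def
        by (simp add: real_sqrt_mult real_sqrt_divide field_simps)
      also have "\<epsilon> n * sqrt (real n) * (\<Lambda> n - ln (\<psi> 0)) / real n
          = \<epsilon> n * (\<Lambda> n - ln (\<psi> 0)) * (sqrt (real n) / real n)"
        by simp
      also have "sqrt (real n) / real n = 1 / sqrt (real n)"
        using elim by (simp add: real_div_sqrt divide_simps)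
      finally show ?case
        by (simp add: diff_divide_distrib right_diff_distrib)
    qed
    have "(\<lambda>n. ln (\<psi> 0) / sqrt (real n)) \<longlonglongrightarrow> 0"
      by real_asymp
    then show "(\<lambda>n. \<epsilon> n * (\<Lambda> n / sqrt (real n) - ln (\<psi> 0) / sqrt (real n))) \<longlonglongrightarrow> 0"
      using tendsto_mult[OF \<epsilon>0 tendsto_diff[OF r0]] by fastforce
  qed simp
  ultimately show ?thesis
    unfolding c_def by blast
qed

section \<open>Coding the unit interval by continued fraction digits\<close>

text \<open>Given the ratio \<open>\<theta>\<close> of the last two denominators, the digits \<open>1, \<dots>, i\<close> together have
  conditional Lebesgue probability \<open>i / (i + 1 + \<theta>)\<close>. Dividing by its value at \<open>i = N\<close>
  conditions on the digit being at most \<open>N\<close>, so the breakpoints cut the unit interval into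
  \<open>N\<close> pieces with the conditional probabilities of the digits as lengths.\<close>

definition breakpoint :: "nat \<Rightarrow> real \<Rightarrow> nat \<Rightarrow> real" where
  "breakpoint N \<theta> i = real i / (real i + 1 + \<theta>) * ((real N + 1 + \<theta>) / real N)"

definition free_digit :: "nat \<Rightarrow> real \<Rightarrow> real \<Rightarrow> nat" where
  "free_digit N \<theta> v = (LEAST i. v < breakpoint N \<theta> i)"

text \<open>The coding of a number \<open>y\<close> by digits. The first component of the state is the ratio of the
  last two denominators; the second component is the remainder of \<open>y\<close>, the position of \<open>y\<close>
  within the interval of all numbers with the same digits so far, rescaled to the unit interval.
  A free position reads a digit off the remainder, an inserted digit leaves it unchanged.\<close>

primrec code_state :: "nat \<Rightarrow> (nat \<Rightarrow> nat) \<Rightarrow> real \<Rightarrow> nat \<Rightarrow> real \<times> real" where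
  "code_state N \<beta> y 0 = (0, y)"
| "code_state N \<beta> y (Suc k) = (case code_state N \<beta> y k of (\<theta>, v) \<Rightarrow>
     if \<beta> k = 0 then
       let i = free_digit N \<theta> v in
         (1 / (real i + \<theta>),
          (v - breakpoint N \<theta> (i - 1)) / (breakpoint N \<theta> i - breakpoint N \<theta> (i - 1)))
     else (1 / (real (\<beta> k) + \<theta>), v))"

definition code_digit :: "nat \<Rightarrow> (nat \<Rightarrow> nat) \<Rightarrow> real \<Rightarrow> nat \<Rightarrow> nat" where
  "code_digit N \<beta> y k = (if \<beta> k = 0 then
     free_digit N (fst (code_state N \<beta> y k)) (snd (code_state N \<beta> y k)) else \<beta> k)"

text \<open>The factor by which, at position \<open>k\<close>, the ratio between the length of an interval of codes
  and the length of the corresponding cylinder may grow. At a free position this comes from the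
  omission of the digits above \<open>N\<close>; at an inserted position the cylinder shrinks and the
  interval of codes does not.\<close>

definition loss :: "nat \<Rightarrow> (nat \<Rightarrow> nat) \<Rightarrow> nat \<Rightarrow> real" where
  "loss N \<beta> k = (if \<beta> k = 0 then (real N + 2) / real N else (real (\<beta> k) + 2)\<^sup>2)"

lemma breakpoint_diff:
  assumes "\<theta> \<ge> 0" "i \<ge> 1"
  shows "breakpoint N \<theta> i - breakpoint N \<theta> (i - 1)
    = (1 + \<theta>) / ((real i + \<theta>) * (real i + 1 + \<theta>)) * ((real N + 1 + \<theta>) / real N)"
proof -
  have "real i + \<theta> > 0" "real i + 1 + \<theta> > 0"
    using assms by (auto intro: add_pos_nonneg)
  then have "real i / (real i + 1 + \<theta>) - real (i - 1) / (real (i - 1) + 1 + \<theta>)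
      = (1 + \<theta>) / ((real i + \<theta>) * (real i + 1 + \<theta>))"
    using assms(2) by (simp add: of_nat_diff field_simps)
  then show ?thesis
    unfolding breakpoint_def left_diff_distrib[symmetric] by (simp only:)
qed

text \<open>The breakpoints run from \<open>0\<close> at \<open>i = 0\<close> to \<open>1\<close> at \<open>i = N\<close>.\<close>

lemma free_digit:
  assumes "N \<ge> 1" "\<theta> \<ge> 0" "v \<in> {0..<1}"
  defines "i \<equiv> free_digit N \<theta> v"
  shows "1 \<le> i" "i \<le> N" "breakpoint N \<theta> (i - 1) \<le> v" "v < breakpoint N \<theta> i"
proof -
  have "breakpoint N \<theta> N = 1"
    using assms by (simp add: breakpoint_def add_nonneg_pos order_less_imp_not_eq2)
  then have vN: "v < breakpoint N \<theta> N"
    using assms by simp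
  then show less: "v < breakpoint N \<theta> i"
    unfolding i_def free_digit_def by (rule LeastI)
  show "i \<le> N"
    unfolding i_def free_digit_def using vN by (rule Least_le)
  have "i \<noteq> 0"
  proof
    assume "i = 0"
    then show False
      using less assms(3) by (simp add: breakpoint_def)
  qed
  then show "1 \<le> i"
    by simp
  then have "\<not> v < breakpoint N \<theta> (i - 1)"
    unfolding i_def free_digit_def by (intro not_less_Least) auto
  then show "breakpoint N \<theta> (i - 1) \<le> v"
    by simp
qed

lemma code_state_bounds:
  assumes "N \<ge> 1" "y \<in> {0..<1}"
  shows "0 \<le> fst (code_state N \<beta> y k) \<and> snd (code_state N \<beta> y k) \<in> {0..<1}"
proof (induction k)
  case (Suc k)
  obtain \<theta> v where st: "code_state N \<beta> y k = (\<theta>, v)"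
    by fastforce
  define i where "i = free_digit N \<theta> v"
  have \<theta>: "\<theta> \<ge> 0" "v \<in> {0..<1}"
    using Suc st by auto
  show ?case
  proof (cases "\<beta> k = 0")
    case True
    have "(v - breakpoint N \<theta> (i - 1)) / (breakpoint N \<theta> i - breakpoint N \<theta> (i - 1)) \<in> {0..<1}"
      using free_digit[OF assms(1) \<theta>] by (simp add: i_def divide_simps)
    then show ?thesis
      using True \<theta> by (simp add: st Let_def i_def)
  next
    case False
    then show ?thesis
      using \<theta> by (simp add: st)
  qed
qed (use assms in simp)

lemma code_digit_bounds:
  assumes "N \<ge> 1" "y \<in> {0..<1}"
  shows "code_digit N \<beta> y k \<ge> 1" "\<beta> k \<le> code_digit N \<beta> y k"
    "code_digit N \<beta> y k \<le> (if \<beta> k = 0 then N else \<beta> k)"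
  using free_digit[OF assms(1), of "fst (code_state N \<beta> y k)" "snd (code_state N \<beta> y k)"]
    code_state_bounds[OF assms, of \<beta> k]
  by (auto simp: code_digit_def)

lemma fst_code_state: "fst (code_state N \<beta> y k) = den_ratio (code_digit N \<beta> y) k"
proof (induction k)
  case (Suc k)
  then show ?case
    by (cases "code_state N \<beta> y k") (simp add: code_digit_def Let_def)
qed simp

text \<open>Codes with the same first \<open>n\<close> digits are hardly further apart than the cylinder is long: at a free
  position the piece between two breakpoints and the cylinder shrink by the same factor except
  for the normalisation \<open>(N + 1 + \<theta>) / N\<close>.\<close>

lemma code_contraction:
  assumes N: "N \<ge> 1" and y: "y \<in> {0..<1}" and z: "z \<in> {0..<1}"
    and agree: "\<And>k. k < n \<Longrightarrow> code_digit N \<beta> y k = code_digit N \<beta> z k"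
  shows "\<bar>y - z\<bar> * inverse_length (code_digit N \<beta> y) n
    \<le> \<bar>snd (code_state N \<beta> y n) - snd (code_state N \<beta> z n)\<bar> * (\<Prod>k<n. loss N \<beta> k)"
  using agree
proof (induction n)
  case 0
  then show ?case by (simp add: inverse_length_def)
next
  case (Suc n)
  define d where "d = code_digit N \<beta> y"
  define \<theta> where "\<theta> = den_ratio d n"
  define v where "v = snd (code_state N \<beta> y n)"
  define w where "w = snd (code_state N \<beta> z n)"
  define v' where "v' = snd (code_state N \<beta> y (Suc n))"
  define w' where "w' = snd (code_state N \<beta> z (Suc n))"
  define R where "R = (d n + \<theta>) * (d n + 1 + \<theta>) / (1 + \<theta>)"
  define G where "G = (\<Prod>k<n. loss N \<beta> k)"
  have d1: "\<And>k. d k \<ge> 1"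
    using code_digit_bounds(1)[OF N y] by (simp add: d_def)
  have \<theta>: "0 \<le> \<theta>" "\<theta> \<le> 1"
    using den_ratio_bounds[of d n] d1 by (auto simp: \<theta>_def)
  have st_y: "code_state N \<beta> y n = (\<theta>, v)"
    using fst_code_state[of N \<beta> y n] by (simp add: prod_eq_iff v_def \<theta>_def d_def)
  have "den_ratio (code_digit N \<beta> z) n = \<theta>"
    unfolding \<theta>_def d_def using Suc.prems by (intro den_ratio_cong) auto
  then have st_z: "code_state N \<beta> z n = (\<theta>, w)"
    using fst_code_state[of N \<beta> z n] by (simp add: prod_eq_iff w_def)
  have R: "R \<ge> 0"
    using \<theta> by (simp add: R_def)
  have G: "G \<ge> 0"
    unfolding G_def by (intro prod_nonneg) (auto simp: loss_def)
  have step: "\<bar>v - w\<bar> * R \<le> \<bar>v' - w'\<bar> * loss N \<beta> n"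
  proof (cases "\<beta> n = 0")
    case True
    define p where "p = breakpoint N \<theta> (d n) - breakpoint N \<theta> (d n - 1)"
    have fd: "free_digit N \<theta> v = d n" "free_digit N \<theta> w = d n"
      using Suc.prems[of n] True by (auto simp: d_def code_digit_def st_y st_z)
    have pR: "p * R = (real N + 1 + \<theta>) / real N"
    proof -
      have "real (d n) + \<theta> > 0" "real (d n) + 1 + \<theta> > 0" "1 + \<theta> > 0"
        using \<theta> d1[of n] by (auto intro: add_pos_nonneg)
      then show ?thesis
        unfolding p_def R_def breakpoint_diff[OF \<theta>(1) d1] by (simp add: add_ac)
    qed
    have "p * R > 0"
      unfolding pR using N \<theta> by (intro divide_pos_pos) auto
    then have p: "p > 0"
      using R by (simp add: zero_less_mult_iff)
    have "v' = (v - breakpoint N \<theta> (d n - 1)) / p" "w' = (w - breakpoint N \<theta> (d n - 1)) / p"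
      using True by (simp_all add: v'_def w'_def st_y st_z fd Let_def p_def)
    then have "v - w = p * (v' - w')"
      using p by (simp add: field_simps)
    then have "\<bar>v - w\<bar> * R = \<bar>v' - w'\<bar> * (p * R)"
      using p by (simp add: abs_mult)
    also have "\<dots> \<le> \<bar>v' - w'\<bar> * ((real N + 2) / real N)"
      unfolding pR using \<theta> by (intro mult_left_mono divide_right_mono) auto
    finally show ?thesis
      using True by (simp add: loss_def)
  next
    case False
    have d_eq: "d n = \<beta> n"
      using False by (simp add: d_def code_digit_def)
    have "R \<le> (\<beta> n + \<theta>) * (\<beta> n + 1 + \<theta>) / 1"
      unfolding R_def d_eq using \<theta> by (intro divide_left_mono) auto
    also have "\<dots> \<le> (real (\<beta> n) + 2)\<^sup>2"
      unfolding power2_eq_square div_by_1 using \<theta> by (intro mult_mono) auto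
    finally have "R \<le> loss N \<beta> n"
      using False by (simp add: loss_def)
    moreover have "v' = v" "w' = w"
      using False by (simp_all add: v'_def w'_def st_y st_z)
    ultimately show ?thesis
      by (simp add: mult_left_mono)
  qed
  have "\<bar>y - z\<bar> * inverse_length d (Suc n) = \<bar>y - z\<bar> * inverse_length d n * R"
    using inverse_length_Suc[of d n] d1 by (simp add: R_def \<theta>_def)
  also have "\<dots> \<le> \<bar>v - w\<bar> * G * R"
    using Suc.IH[OF Suc.prems] R by (intro mult_right_mono) (auto simp: d_def v_def w_def G_def)
  also have "\<dots> = \<bar>v - w\<bar> * R * G"
    by simp
  also have "\<dots> \<le> \<bar>v' - w'\<bar> * loss N \<beta> n * G"
    using step G by (rule mult_right_mono)
  finally show ?case
    by (simp add: d_def v'_def w'_def G_def mult.assoc mult.commute mult.left_commute del: code_state.simps)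
qed

text \<open>Let \<open>n\<close> be the first place where the codes differ, \<open>M\<close> the reciprocal of the length of the
  common cylinder, and \<open>W\<close> the loss in \<open>dist_ge_if_coeffs_differ\<close>. The codes are within
  \<open>(\<Prod>k<n. loss N \<beta> k) / M\<close> of each other and the points are at least \<open>1 / (W * M)\<close> apart.
  The product of all losses is at most \<open>C * 2 powr ((1 - s) * n)\<close>, and \<open>2 ^ n \<le> M\<close> turns this
  into \<open>C * M powr (1 - s)\<close>, the price of lowering the exponent from \<open>1\<close> to \<open>s\<close>.\<close>

lemma code_inverse_holder:
  assumes s: "0 < s" "s < 1" and N: "N \<ge> 1" and C: "C > 0"
    and budget: "\<And>n. (\<Prod>k<n. loss N \<beta> k) * (4 * (real N + 1)\<^sup>2 * (real (max N (\<beta> (n + 2))) + 1))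
      \<le> C * 2 powr ((1 - s) * real n)"
    and y: "y \<in> {0..<1}" and z: "z \<in> {0..<1}"
    and x: "x \<in> unit_irrationals" "\<And>k. cf_coeff (Suc k) x = code_digit N \<beta> y k"
    and x': "x' \<in> unit_irrationals" "\<And>k. cf_coeff (Suc k) x' = code_digit N \<beta> z k"
  shows "\<bar>y - z\<bar> \<le> C * dist x x' powr s"
proof -
  define M where "M = inverse_length (code_digit N \<beta> y)"
  define W where "W n = 4 * (real N + 1)\<^sup>2 * (real (max N (\<beta> (n + 2))) + 1)" for n
  have M: "2 ^ n \<le> M n" for n
    unfolding M_def using code_digit_bounds(1)[OF N y] by (rule inverse_length_ge)
  have M_pos: "M n > 0" for n
    using M[of n] by (rule less_le_trans[rotated]) simp
  have W: "W n \<ge> 1" for n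
  proof -
    have "1 * 1 * 1 \<le> W n"
      unfolding W_def by (intro mult_mono) (auto intro: one_le_power)
    then show ?thesis by simp
  qed
  have contract: "\<bar>y - z\<bar> \<le> C * 2 powr ((1 - s) * real n) / (W n * M n)"
    if "\<And>k. k < n \<Longrightarrow> code_digit N \<beta> y k = code_digit N \<beta> z k" for n
  proof -
    have "\<bar>snd (code_state N \<beta> y n) - snd (code_state N \<beta> z n)\<bar> \<le> 1"
      using code_state_bounds[OF N y, of \<beta> n] code_state_bounds[OF N z, of \<beta> n] by auto
    then have "\<bar>snd (code_state N \<beta> y n) - snd (code_state N \<beta> z n)\<bar> * (\<Prod>k<n. loss N \<beta> k)
        \<le> 1 * (\<Prod>k<n. loss N \<beta> k)"
      by (intro mult_right_mono prod_nonneg) (auto simp: loss_def)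
    then have "\<bar>y - z\<bar> * M n \<le> (\<Prod>k<n. loss N \<beta> k)"
      using code_contraction[OF N y z that] unfolding M_def by force
    then have "\<bar>y - z\<bar> * M n * W n \<le> (\<Prod>k<n. loss N \<beta> k) * W n"
      using W[of n] by (intro mult_right_mono) auto
    also have "\<dots> \<le> C * 2 powr ((1 - s) * real n)"
      unfolding W_def by (rule budget)
    finally show ?thesis
      using M_pos[of n] W[of n] by (simp add: pos_le_divide_eq mult_ac)
  qed
  show ?thesis
  proof (cases "\<exists>n. code_digit N \<beta> y n \<noteq> code_digit N \<beta> z n")
    case False
    \<comment> \<open>Codes that never separate coincide, as the bound for common prefixes tends to \<open>0\<close>.\<close>
    have "\<bar>y - z\<bar> \<le> C * (2 powr (- s)) ^ n" for n
    proof -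
      have "1 * 2 ^ n \<le> W n * M n"
        using M[of n] W[of n] by (intro mult_mono) auto
      then have "C * 2 powr ((1 - s) * real n) / (W n * M n) \<le> C * 2 powr ((1 - s) * real n) / 2 ^ n"
        using C M_pos[of n] W[of n] by (intro divide_left_mono mult_pos_pos) auto
      also have "\<dots> = C * (2 powr (- s)) ^ n"
      proof -
        have "2 powr ((1 - s) * real n) = 2 ^ n * (2 powr (- s)) ^ n"
          by (simp add: powr_realpow[symmetric] powr_powr powr_add[symmetric] algebra_simps)
        then show ?thesis by simp
      qed
      finally show ?thesis
        using contract[of n] False by simp
    qed
    moreover have "(\<lambda>n. C * (2 powr (- s)) ^ n) \<longlonglongrightarrow> C * 0"
      using s by (intro tendsto_mult tendsto_const LIMSEQ_power_zero) (simp add: powr_less_one)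
    ultimately have "\<bar>y - z\<bar> \<le> C * 0"
      by (intro LIMSEQ_le_const[of "\<lambda>n. C * (2 powr (- s)) ^ n"]) auto
    also have "\<dots> \<le> C * dist x x' powr s"
      using C by simp
    finally show ?thesis .
  next
    case True
    define n where "n = (LEAST n. code_digit N \<beta> y n \<noteq> code_digit N \<beta> z n)"
    have diff: "code_digit N \<beta> y n \<noteq> code_digit N \<beta> z n"
      unfolding n_def using True by (rule LeastI_ex)
    have agree: "code_digit N \<beta> y k = code_digit N \<beta> z k" if "k < n" for k
      using not_less_Least that unfolding n_def by blast
    \<comment> \<open>Inserted digits are common to all codes, so the separation happens at a free position.\<close>
    have "\<beta> n = 0"
      using diff unfolding code_digit_def by presburger
    then have le_N: "code_digit N \<beta> y n \<le> N" "code_digit N \<beta> z n \<le> N"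
      using code_digit_bounds(3)[OF N y, of \<beta> n] code_digit_bounds(3)[OF N z, of \<beta> n] by auto
    have le_D: "code_digit N \<beta> y (n + 2) \<le> max N (\<beta> (n + 2))"
      "code_digit N \<beta> z (n + 2) \<le> max N (\<beta> (n + 2))"
      using code_digit_bounds(3)[OF N y, of \<beta> "n + 2"] code_digit_bounds(3)[OF N z, of \<beta> "n + 2"]
      by (auto split: if_splits)
    have "1 / (4 * (real N + 1)\<^sup>2 * (real (max N (\<beta> (n + 2))) + 1) * inverse_length (\<lambda>k. cf_coeff (Suc k) x) n)
        \<le> \<bar>x - x'\<bar>"
    proof (rule dist_ge_if_coeffs_differ[OF x(1) x'(1)])
      have eq: "n + 3 = Suc (n + 2)" by simp
      show "cf_coeff (n + 3) x \<le> max N (\<beta> (n + 2))" "cf_coeff (n + 3) x' \<le> max N (\<beta> (n + 2))"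
        unfolding eq x(2) x'(2) by (fact le_D)+
    qed (use agree diff le_N in \<open>auto simp: x(2) x'(2)\<close>)
    then have gap: "1 / (W n * M n) \<le> dist x x'"
      by (simp add: W_def M_def x(2) dist_real_def)
    have "\<bar>y - z\<bar> \<le> C * 2 powr ((1 - s) * real n) / (W n * M n)"
      by (rule contract[OF agree])
    also have "\<dots> \<le> C * (W n * M n) powr (1 - s) / (W n * M n)"
    proof -
      have "2 powr ((1 - s) * real n) = (2 ^ n) powr (1 - s)"
        by (simp add: powr_realpow[symmetric] powr_powr mult.commute)
      also have "\<dots> \<le> (W n * M n) powr (1 - s)"
        using s M[of n] mult_mono[OF W[of n] M[of n]] by (intro powr_mono2) (auto intro: order_trans[OF zero_le_one W])
      finally show ?thesis
        using C M_pos[of n] W[of n] by (intro divide_right_mono mult_left_mono) auto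
    qed
    also have "\<dots> = C * (1 / (W n * M n)) powr s"
    proof -
      have "W n * M n > 0"
        using M_pos[of n] W[of n] by (intro mult_pos_pos) auto
      then show ?thesis
        by (simp add: powr_diff powr_divide del: mult_pos_pos)
    qed
    also have "\<dots> \<le> C * dist x x' powr s"
      using C s gap M_pos[of n] W[of n] by (intro mult_left_mono powr_mono2) auto
    finally show ?thesis .
  qed
qed

definition inserted_cost :: "(nat \<Rightarrow> nat) \<Rightarrow> nat \<Rightarrow> real" where
  "inserted_cost \<beta> k = (if \<beta> k = 0 then 0 else ln (real (\<beta> k) + 2))"

text \<open>The losses at free positions multiply to at most \<open>exp (2 * n / N)\<close>, and the losses
  through inserted digits to \<open>exp (o(n))\<close>. Both fit into any exponential budget once \<open>N\<close> is
  large; this choice of \<open>N\<close> depends on \<open>s\<close>.\<close>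

lemma exp_budget:
  assumes s: "s < 1"
    and small: "(\<lambda>n. (\<Sum>k<n. inserted_cost \<beta> k) / real n) \<longlonglongrightarrow> 0"
  shows "\<exists>N \<ge> 1. \<exists>C > 0. \<forall>n. (\<Prod>k<n. loss N \<beta> k) *
      (4 * (real N + 1)\<^sup>2 * (real (max N (\<beta> (n + 2))) + 1)) \<le> C * 2 powr ((1 - s) * real n)"
proof -
  define c where "c = inserted_cost \<beta>"
  \<comment> \<open>The budget \<open>(1 - s) * ln 2\<close> per digit is split into four parts of size \<open>\<delta>\<close>: two for the
    truncation at \<open>N\<close> and two for the inserted digits, which enter squared.\<close>
  define \<delta> where "\<delta> = (1 - s) * ln 2 / 4"
  have \<delta>: "\<delta> > 0"
    using s by (simp add: \<delta>_def)
  have c: "c k \<ge> 0" for k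
    by (simp add: c_def inserted_cost_def)
  have c_mono: "(\<Sum>k<m. c k) \<le> (\<Sum>k<n. c k)" if "m \<le> n" for m n
    using that c by (intro sum_mono2) auto
  have "\<forall>\<^sub>F n in sequentially. (\<Sum>k<n. c k) / real n < \<delta>"
    unfolding c_def using order_tendstoD(2)[OF small \<delta>] .
  then obtain n0 where n0: "\<And>n. n \<ge> n0 \<Longrightarrow> (\<Sum>k<n. c k) / real n < \<delta>"
    by (auto simp: eventually_sequentially)
  define K where "K = (\<Sum>k<n0. c k)"
  have K: "K \<ge> 0"
    unfolding K_def by (intro sum_nonneg c)
  have sum_c: "(\<Sum>k<n. c k) \<le> \<delta> * real n + K" for n
  proof (cases "n \<ge> n0 \<and> n > 0")
    case True
    then have "(\<Sum>k<n. c k) < \<delta> * real n"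
      using n0[of n] by (simp add: pos_divide_less_eq)
    then show ?thesis using K by simp
  next
    case False
    then have "(\<Sum>k<n. c k) \<le> K"
      unfolding K_def by (intro c_mono) auto
    then show ?thesis
      using \<delta> by (simp add: add_increasing)
  qed
  obtain N where N: "N \<ge> 1" "2 / real N \<le> 2 * \<delta>"
  proof -
    obtain m where m: "1 / \<delta> < real m"
      using reals_Archimedean2 by blast
    moreover have "1 / \<delta> > 0" using \<delta> by simp
    ultimately have "real m > 0" by linarith
    then have "m \<ge> 1" "2 / real m \<le> 2 * \<delta>"
      using m \<delta> by (auto simp: field_simps)
    then show ?thesis using that by blast
  qed
  define C where "C = 4 * (real N + 1) ^ 3 * exp (6 * \<delta> + 2 * K)"
  have "(\<Prod>k<n. loss N \<beta> k) * (4 * (real N + 1)\<^sup>2 * (real (max N (\<beta> (n + 2))) + 1))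
      \<le> C * 2 powr ((1 - s) * real n)" for n
  proof -
    have "loss N \<beta> k \<le> exp (2 / real N + 2 * c k)" for k
    proof (cases "\<beta> k = 0")
      case True
      then show ?thesis
        using exp_ge_add_one_self[of "2 / real N"] N(1)
        by (simp add: loss_def c_def inserted_cost_def add_divide_distrib)
    next
      case False
      then have "loss N \<beta> k = exp (2 * c k)"
        by (simp add: loss_def c_def inserted_cost_def exp_double)
      then show ?thesis by simp
    qed
    then have "(\<Prod>k<n. loss N \<beta> k) \<le> (\<Prod>k<n. exp (2 / real N + 2 * c k))"
      by (intro prod_mono) (auto simp: loss_def)
    also have "\<dots> = exp (2 / real N * real n + 2 * (\<Sum>k<n. c k))"
      by (simp add: exp_sum[symmetric] sum.distrib sum_distrib_left mult.commute)
    finally have 1: "(\<Prod>k<n. loss N \<beta> k) \<le> exp (2 / real N * real n + 2 * (\<Sum>k<n. c k))" .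
    have "real (max N (\<beta> (n + 2))) + 1 \<le> (real N + 1) * exp (c (n + 2))"
    proof (cases "\<beta> (n + 2) = 0")
      case False
      then have "real (max N (\<beta> (n + 2))) + 1 \<le> (real N + 1) * (real (\<beta> (n + 2)) + 2)"
        by (simp add: max_def algebra_simps add_increasing)
      then show ?thesis
        using False by (simp add: c_def inserted_cost_def)
    qed (simp add: c_def inserted_cost_def)
    then have "4 * (real N + 1)\<^sup>2 * (real (max N (\<beta> (n + 2))) + 1)
        \<le> 4 * (real N + 1)\<^sup>2 * ((real N + 1) * exp (c (n + 2)))"
      by (intro mult_left_mono) auto
    also have "\<dots> = 4 * (real N + 1) ^ 3 * exp (c (n + 2))"
      by (simp add: power2_eq_square power3_eq_cube)
    finally have 2: "4 * (real N + 1)\<^sup>2 * (real (max N (\<beta> (n + 2))) + 1)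
        \<le> 4 * (real N + 1) ^ 3 * exp (c (n + 2))" .
    have "(\<Prod>k<n. loss N \<beta> k) * (4 * (real N + 1)\<^sup>2 * (real (max N (\<beta> (n + 2))) + 1))
        \<le> exp (2 / real N * real n + 2 * (\<Sum>k<n. c k)) * (4 * (real N + 1) ^ 3 * exp (c (n + 2)))"
      by (rule mult_mono[OF 1 2]) auto
    also have "\<dots> = 4 * (real N + 1) ^ 3 * exp (2 / real N * real n + 2 * (\<Sum>k<n. c k) + c (n + 2))"
      by (simp add: exp_add)
    also have "\<dots> \<le> 4 * (real N + 1) ^ 3 * exp (6 * \<delta> + 2 * K + (1 - s) * ln 2 * real n)"
    proof -
      have "2 / real N * real n \<le> 2 * \<delta> * real n"
        using N(2) by (intro mult_right_mono) auto
      moreover have "2 * (\<Sum>k<n. c k) + c (n + 2) \<le> 2 * (\<Sum>k<n + 3. c k)"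
        using c[of n] c[of "n + 1"] c[of "n + 2"] by (simp add: numeral_3_eq_3)
      moreover have "(\<Sum>k<n + 3. c k) \<le> \<delta> * real (n + 3) + K"
        by (rule sum_c)
      ultimately have "2 / real N * real n + 2 * (\<Sum>k<n. c k) + c (n + 2)
          \<le> 6 * \<delta> + 2 * K + 4 * \<delta> * real n"
        by (simp add: algebra_simps)
      also have "4 * \<delta> = (1 - s) * ln 2"
        by (simp add: \<delta>_def)
      finally show ?thesis
        by (intro mult_left_mono) auto
    qed
    also have "\<dots> = C * 2 powr ((1 - s) * real n)"
      by (simp add: C_def powr_def exp_add mult.assoc mult.commute mult.left_commute)
    finally show ?thesis .
  qed
  moreover have "C > 0"
    unfolding C_def by (intro mult_pos_pos) (auto intro: add_nonneg_pos)
  ultimately show ?thesis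
    using N(1) by blast
qed

section \<open>Continued fractions with prescribed growth of digit sums\<close>

text \<open>Superlinear growth makes \<open>ln (f n)\<close> eventually positive, so that the upper limit is a limit.\<close>

lemma log_growth_if_limsup_zero:
  fixes f :: "nat \<Rightarrow> real"
  assumes superlinear: "filterlim (\<lambda>n. f n / real n) at_top sequentially"
    and limsup: "limsup (\<lambda>n. ereal (ln (f n) / sqrt (real n))) = 0"
  shows "(\<lambda>n. ln (f n + 3) / sqrt (real n)) \<longlonglongrightarrow> 0"
proof -
  have "\<forall>\<^sub>F n in sequentially. f n / real n \<ge> 3"
    using superlinear by (auto simp: filterlim_at_top)
  then have large: "\<forall>\<^sub>F n in sequentially. f n \<ge> 3"
    using eventually_ge_at_top[of 1]
  proof eventually_elim
    case (elim n)
    then have "3 * real n \<le> f n" by (simp add: field_simps)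
    moreover have "3 \<le> 3 * real n" using elim by simp
    ultimately show ?case by linarith
  qed
  have g: "(\<lambda>n. ln (f n) / sqrt (real n)) \<longlonglongrightarrow> 0"
  proof (rule order_tendstoI)
    fix a :: real assume "a < 0"
    show "\<forall>\<^sub>F n in sequentially. a < ln (f n) / sqrt (real n)"
      using large
    proof eventually_elim
      case (elim n)
      then have "0 \<le> ln (f n) / sqrt (real n)" by simp
      with \<open>a < 0\<close> show ?case by linarith
    qed
  next
    fix a :: real assume "0 < a"
    then have "limsup (\<lambda>n. ereal (ln (f n) / sqrt (real n))) < ereal a"
      using limsup by simp
    then have "\<forall>\<^sub>F n in sequentially. ereal (ln (f n) / sqrt (real n)) < ereal a"
      by (rule Limsup_lessD)
    then show "\<forall>\<^sub>F n in sequentially. ln (f n) / sqrt (real n) < a"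
      by simp
  qed
  show ?thesis
  proof (rule tendsto_sandwich)
    show "\<forall>\<^sub>F n in sequentially. 0 \<le> ln (f n + 3) / sqrt (real n)"
      using large by eventually_elim simp
    show "\<forall>\<^sub>F n in sequentially. ln (f n + 3) / sqrt (real n)
        \<le> ln 2 / sqrt (real n) + ln (f n) / sqrt (real n)"
      using large
    proof eventually_elim
      case (elim n)
      have "ln (f n + 3) \<le> ln (2 * f n)"
        using elim by simp
      also have "\<dots> = ln 2 + ln (f n)"
        using elim by (simp add: ln_mult)
      finally show ?case
        by (simp add: add_divide_distrib[symmetric] divide_right_mono)
    qed
    have "(\<lambda>n. ln 2 / sqrt (real n)) \<longlonglongrightarrow> 0"
      by real_asymp
    then show "(\<lambda>n. ln 2 / sqrt (real n) + ln (f n) / sqrt (real n)) \<longlonglongrightarrow> 0"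
      using tendsto_add[OF _ g] by fastforce
  qed simp
qed

text \<open>The free digits contribute at most \<open>N * n\<close> to the sum, which is negligible.\<close>

lemma cf_sum_tendsto:
  assumes pos: "\<And>n. n \<ge> 1 \<Longrightarrow> f n > 0"
    and superlinear: "filterlim (\<lambda>n. f n / real n) at_top sequentially"
    and main: "(\<lambda>n. (\<Sum>k<n. real (\<beta> k)) / f n) \<longlonglongrightarrow> 1"
    and digits: "\<And>k. \<beta> k \<le> cf_coeff (Suc k) x" "\<And>k. cf_coeff (Suc k) x \<le> \<beta> k + N"
  shows "(\<lambda>n. real (cf_sum n x) / f n) \<longlonglongrightarrow> 1"
proof (rule tendsto_sandwich[OF _ _ main])
  have sum: "real (cf_sum n x) = (\<Sum>k<n. real (cf_coeff (Suc k) x))" for n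
    unfolding cf_sum_def of_nat_sum
    by (rule sum.reindex_bij_witness[of _ Suc "\<lambda>k. k - 1"]) auto
  show "\<forall>\<^sub>F n in sequentially. (\<Sum>k<n. real (\<beta> k)) / f n \<le> real (cf_sum n x) / f n"
    using eventually_ge_at_top[of 1]
  proof eventually_elim
    case (elim n)
    have "(\<Sum>k<n. real (\<beta> k)) \<le> real (cf_sum n x)"
      unfolding sum using digits(1) by (intro sum_mono) simp
    then show ?case
      using pos[OF elim] by (simp add: divide_right_mono)
  qed
  show "\<forall>\<^sub>F n in sequentially. real (cf_sum n x) / f n
      \<le> (\<Sum>k<n. real (\<beta> k)) / f n + real N * (real n / f n)"
    using eventually_ge_at_top[of 1]
  proof eventually_elim
    case (elim n)
    have "real (cf_sum n x) \<le> (\<Sum>k<n. real (\<beta> k) + real N)"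
      unfolding sum using digits(2) by (intro sum_mono) (simp flip: of_nat_add)
    also have "\<dots> = (\<Sum>k<n. real (\<beta> k)) + real N * real n"
      by (simp add: sum.distrib)
    finally show ?case
      using pos[OF elim] by (simp add: divide_right_mono flip: add_divide_distrib)
  qed
  have "(\<lambda>n. real n / f n) \<longlonglongrightarrow> 0"
    using tendsto_inverse_0_at_top[OF superlinear] by (simp add: inverse_eq_divide)
  then show "(\<lambda>n. (\<Sum>k<n. real (\<beta> k)) / f n + real N * (real n / f n)) \<longlonglongrightarrow> 1"
    using tendsto_add[OF main tendsto_mult[OF tendsto_const]] by fastforce
qed

theorem theorem4:
  fixes \<phi> :: "real \<Rightarrow> real"
  assumes "\<And>t. t > 0 \<Longrightarrow> \<phi> t > 0"
    and "mono_on {0<..} \<phi>"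
    and "filterlim (\<lambda>n::nat. \<phi> (real n) / real n) at_top sequentially"
    and "limsup (\<lambda>n::nat. ereal (ln (\<phi> (real n)) / sqrt (real n))) = 0"
  shows "hausdorff_dim (cf_sum_set \<phi>) = 1"
proof (rule hausdorff_dim_eq_1I)
  show "cf_sum_set \<phi> \<subseteq> {0..1}"
    by (auto simp: cf_sum_set_def unit_irrationals_def)
next
  fix s :: real assume s: "0 < s" "s < 1"
  define f where "f n = \<phi> (real n)" for n
  have pos: "f n > 0" if "n \<ge> 1" for n
    using assms(1) that by (simp add: f_def)
  have mono: "f m \<le> f n" if "1 \<le> m" "m \<le> n" for m n
    unfolding f_def using that by (intro mono_onD[OF assms(2)]) auto
  have superlinear: "filterlim (\<lambda>n. f n / real n) at_top sequentially"
    using assms(3) by (simp add: f_def)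
  have growth: "(\<lambda>n. ln (f n + 3) / sqrt (real n)) \<longlonglongrightarrow> 0"
    using superlinear assms(4) unfolding f_def by (rule log_growth_if_limsup_zero)
  obtain \<beta> where \<beta>: "(\<lambda>n. (\<Sum>k<n. real (\<beta> k)) / f n) \<longlonglongrightarrow> 1"
    "(\<lambda>n. (\<Sum>k<n. inserted_cost \<beta> k) / real n) \<longlonglongrightarrow> 0"
    using jump_sequence_exists[OF pos mono superlinear growth] unfolding inserted_cost_def by blast
  obtain N C where N: "N \<ge> 1" and C: "C > 0" and
    budget: "\<And>n. (\<Prod>k<n. loss N \<beta> k) * (4 * (real N + 1)\<^sup>2 * (real (max N (\<beta> (n + 2))) + 1))
      \<le> C * 2 powr ((1 - s) * real n)"
    using exp_budget[OF s(2) \<beta>(2)] by blast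
  have "\<forall>y \<in> {0..<1}. \<exists>x \<in> unit_irrationals. \<forall>k. cf_coeff (Suc k) x = code_digit N \<beta> y k"
    using cf_with_coeffs_exists code_digit_bounds(1)[OF N] by blast
  then obtain h where h: "\<And>y. y \<in> {0..<1} \<Longrightarrow> h y \<in> unit_irrationals"
    "\<And>y k. y \<in> {0..<1} \<Longrightarrow> cf_coeff (Suc k) (h y) = code_digit N \<beta> y k"
    by metis
  have "h y \<in> cf_sum_set \<phi>" if y: "y \<in> {0..<1}" for y
  proof -
    have "code_digit N \<beta> y k \<le> \<beta> k + N" for k
      using code_digit_bounds(3)[OF N y, of \<beta> k] by (auto split: if_splits)
    then have "(\<lambda>n. real (cf_sum n (h y)) / f n) \<longlonglongrightarrow> 1"
      using code_digit_bounds(2)[OF N y]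
      by (intro cf_sum_tendsto[OF pos superlinear \<beta>(1), where N = N]) (auto simp: h(2)[OF y])
    then show ?thesis
      using h(1)[OF y] by (simp add: cf_sum_set_def f_def)
  qed
  then have "h ` {0..<1} \<subseteq> cf_sum_set \<phi>"
    by blast
  moreover have "\<bar>y - z\<bar> \<le> C * dist (h y) (h z) powr s" if "y \<in> {0..<1}" "z \<in> {0..<1}" for y z
    using that by (intro code_inverse_holder[OF s N C budget]) (auto simp: h)
  ultimately show "hausdorff_measure s (cf_sum_set \<phi>) \<noteq> 0"
    using s(1) C by (intro hausdorff_measure_pos_if_inverse_holder[of s C h])
qed

end
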